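(* Let $d\ge 1$ be an integer, let $N,\delta,r,\sigma>0$, and let $v:\mathbb{R}^d\to\mathbb{C}$ and $w:[-r,r]^d\to\mathbb{C}$ be such that $$\|v\|_{L^1(\mathbb{R}^d)}\le (2\pi)^d N,\qquad \operatorname{supp}(v)\subseteq\Big\{x\in\mathbb{R}^d:\sum_{j=1}^d|x_j|\le\sigma\Big\},\qquad \|w-\mathcal{F}v\|_{L^\infty([-r,r]^d)}\le\delta<N.$$ Let $\rho,R>0$ be such that $R\ge r$ and $\rho\ge 4R/r$. Then $$\|\mathcal{F}v-\mathcal{C}_{R,n^*}[w]\|_{L^\infty([-R,R]^d)}\le\Big(\frac{16}{3}\Big)^d\,\frac{R}{r}\left(\frac{Ne^{r\sigma\rho}}{\delta}\right)^{\tau(\rho)}\delta,$$ where $$n^*=\left\lceil\frac{\ln\frac N\delta+r\sigma\rho}{\ln(3\rho)}\right\rceil\qquad\text{and}\qquad\tau(\rho)=\frac{\ln\frac{4R}{r}}{\ln(3\rho)}.$$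
   Context: Fourier transform: $\mathcal{F}v(\xi)=\frac{1}{(2\pi)^d}\int_{\mathbb{R}^d}e^{i\xi x}v(x)\,dx$ for $\xi\in\mathbb{R}^d$, where $\xi x$ is the scalar product. $\mathbb{N}=\{0,1,2,\dots\}$. $T_k$ ($k\in\mathbb{N}$) are the Chebyshev polynomials, $T_k(t)=\cos(k\arccos t)$ for $t\in[-1,1]$, extended as polynomials to all $t\in\mathbb{R}$. $\mathbf{1}[k>0]$ equals $1$ if $k>0$ and $0$ otherwise. For a function $w$ on $[-r,r]^d$ and $k_1,\dots,k_d\in\mathbb{N}$ put $$a_{k_1,\dots,k_d}[w]=\int_{-r}^r\cdots\int_{-r}^r w(\xi)\prod_{j=1}^d\left(\frac{2^{\mathbf{1}[k_j>0]}\,T_{k_j}(\xi_j/r)}{\pi(r^2-\xi_j^2)^{1/2}}\right)d\xi_1\cdots d\xi_d.$$ For $R\ge r$ and $n\in\mathbb{N}$, $\mathcal{C}_{R,n}[w]:\mathbb{R}^d\to\mathbb{C}$ is defined by: $\mathcal{C}_{R,n}[w](\xi)=w(\xi)$ for $\xi\in[-r,r]^d$; $$\mathcal{C}_{R,n}[w](\xi)=\sum_{\substack{k_1,\dots,k_d\in\mathbb{N}\\ k_1+\cdots+k_d<n}}a_{k_1,\dots,k_d}[w]\prod_{j=1}^dT_{k_j}\Big(\frac{\xi_j}{r}\Big)\quad\text{for }\xi\in[-R,R]^d\setminus[-r,r]^d;$$ and $\mathcal{C}_{R,n}[w](\xi)=0$ for $\xi\in\mathbb{R}^d\setminus[-R,R]^d$.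 (For $n=0$, $\mathcal{C}_{R,n}[w]$ is $0$ everywhere outside $[-r,r]^d$.) *)

theory Defs
  imports
    "HOL-Analysis.Analysis"
    "HOL-Computational_Algebra.Polynomial"
    "HOL-Probability.Essential_Supremum"
begin

text \<open>
  The space \<open>\<real>\<^sup>d\<close> is the type \<^typ>\<open>real ^ 'd\<close> with \<open>d = CARD('d)\<close>, which is at least 1.
\<close>

definition cube :: "real \<Rightarrow> (real ^ 'd) set" where
  "cube r = {\<xi>. \<forall>j. \<xi> $ j \<in> {-r..r}}"

text \<open>
  Both norms take the value \<open>\<infinity>\<close> on functions that are not Lebesgue measurable, so a finite bound
  on a norm includes measurability (the same convention as for \<^const>\<open>esssup\<close>).
  In \<open>Linf_norm S f\<close> the values of \<open>f\<close> outside \<open>S\<close> play no role.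
\<close>

definition L1_norm :: "(real ^ 'd \<Rightarrow> complex) \<Rightarrow> ennreal" where
  "L1_norm f =
    (if f \<in> borel_measurable lebesgue then \<integral>\<^sup>+ x. ennreal (norm (f x)) \<partial>lebesgue else \<infinity>)"

definition Linf_norm :: "(real ^ 'd) set \<Rightarrow> (real ^ 'd \<Rightarrow> complex) \<Rightarrow> ennreal" where
  "Linf_norm S f =
    (if f \<in> borel_measurable (lebesgue_on S)
     then esssup (lebesgue_on S) (\<lambda>x. ennreal (norm (f x))) else \<infinity>)"

text \<open>
  The support of (the class of) a measurable function: the complement of the largest open set
  on which the function vanishes almost everywhere. It is contained in the closure of
  \<open>{x. f x \<noteq> 0}\<close>, and coincides with that closure when \<open>f\<close> is continuous.
\<close>

definition supp :: "(real ^ 'd \<Rightarrow> complex) \<Rightarrow> (real ^ 'd) set" where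
  "supp f = - \<Union>{U. open U \<and> (AE x in lebesgue. x \<in> U \<longrightarrow> f x = 0)}"

definition fourier :: "(real ^ 'd \<Rightarrow> complex) \<Rightarrow> real ^ 'd \<Rightarrow> complex" where
  "fourier v \<xi> =
    1 / (2 * of_real pi) ^ CARD('d) * (\<integral>x. exp (\<i> * of_real (\<xi> \<bullet> x)) * v x \<partial>lebesgue)"

definition chebyshev_T :: "nat \<Rightarrow> real poly" where
  "chebyshev_T k = (THE p. \<forall>t\<in>{-1..1}. poly p t = cos (real k * arccos t))"

lemma chebyshev_T_ex1: "\<exists>!p. \<forall>t\<in>{-1..1}. poly p t = cos (real k * arccos t)"
proof (rule ex_ex1I)
  have step: "cos (real (Suc (Suc m)) * a) = 2 * cos a * cos (real (Suc m) * a) - cos (real m * a)"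
    for m and a :: real
    using cos_add[of "real (Suc m) * a" a] cos_diff[of "real (Suc m) * a" a]
    by (simp add: algebra_simps)
  show "\<exists>p. \<forall>t\<in>{-1..1}. poly p t = cos (real k * arccos t)"
  proof (induction k rule: induct_nat_012)
    case 0
    show ?case by (rule exI[of _ 1]) simp
  next
    case 1
    show ?case by (rule exI[of _ "[:0, 1:]"]) simp
  next
    case (ge2 m)
    then obtain p q where "\<forall>t\<in>{-1..1}. poly p t = cos (real m * arccos t)"
      and "\<forall>t\<in>{-1..1}. poly q t = cos (real (Suc m) * arccos t)"
      by blast
    then have "\<forall>t\<in>{-1..1}.
        poly ([:0, 2:] * q - p) t = cos (real (Suc (Suc m)) * arccos t)"
      unfolding step by simp
    then show ?case by blast
  qed
next
  fix p q :: "real poly"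
  assume p: "\<forall>t\<in>{-1..1}. poly p t = cos (real k * arccos t)"
    and q: "\<forall>t\<in>{-1..1}. poly q t = cos (real k * arccos t)"
  have "{-1..1} \<subseteq> {t. poly (p - q) t = 0}"
    using p q by auto
  moreover have "infinite {-1..1::real}"
    by (rule infinite_Icc) simp
  ultimately have "infinite {t. poly (p - q) t = 0}"
    using finite_subset by blast
  then have "p - q = 0"
    using poly_roots_finite by blast
  then show "p = q" by simp
qed

lemma poly_chebyshev_T: "t \<in> {-1..1} \<Longrightarrow> poly (chebyshev_T k) t = cos (real k * arccos t)"
  using theI'[OF chebyshev_T_ex1[of k]] unfolding chebyshev_T_def by blast

definition cheb_coeff :: "real \<Rightarrow> (real ^ 'd \<Rightarrow> complex) \<Rightarrow> ('d \<Rightarrow> nat) \<Rightarrow> complex" where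
  "cheb_coeff r w k =
    (\<integral>\<xi>\<in>cube r. w \<xi> *
       of_real (\<Prod>j\<in>UNIV. 2 ^ of_bool (k j > 0) * poly (chebyshev_T (k j)) (\<xi> $ j / r) /
                        (pi * sqrt (r\<^sup>2 - (\<xi> $ j)\<^sup>2))) \<partial>lebesgue)"

text \<open>\<open>cheb_extend r R n w\<close> is the function \<open>\<C>\<^bsub>R,n\<^esub>[w]\<close>, for data \<open>w\<close> on \<open>[-r,r]\<^sup>d\<close>.\<close>

definition cheb_extend ::
    "real \<Rightarrow> real \<Rightarrow> nat \<Rightarrow> (real ^ 'd \<Rightarrow> complex) \<Rightarrow> real ^ 'd \<Rightarrow> complex" where
  "cheb_extend r R n w \<xi> =
    (if \<xi> \<in> cube r then w \<xi>
     else if \<xi> \<in> cube R then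
       (\<Sum>k | (\<Sum>j\<in>UNIV. k j) < n.
          cheb_coeff r w k * of_real (\<Prod>j\<in>UNIV. poly (chebyshev_T (k j)) (\<xi> $ j / r)))
     else 0)"

lemma finite_multi_indices: "finite {k :: 'd::finite \<Rightarrow> nat. (\<Sum>j\<in>UNIV. k j) < n}"
proof (rule finite_subset)
  show "{k :: 'd \<Rightarrow> nat. (\<Sum>j\<in>UNIV. k j) < n} \<subseteq> Pi\<^sub>E UNIV (\<lambda>_. {..<n})"
  proof
    fix k :: "'d \<Rightarrow> nat"
    assume "k \<in> {k. (\<Sum>j\<in>UNIV. k j) < n}"
    moreover have "k i \<le> (\<Sum>j\<in>UNIV. k j)" for i
      by (rule member_le_sum) auto
    ultimately show "k \<in> Pi\<^sub>E UNIV (\<lambda>_. {..<n})"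
      by (auto simp: PiE_UNIV_domain intro: le_less_trans)
  qed
  show "finite (Pi\<^sub>E (UNIV :: 'd set) (\<lambda>_. {..<n}))"
    by (rule finite_PiE) auto
qed

end

theory Submission
  imports Defs
begin

text \<open>
  The Fourier transform \<open>F\<close> of a function with compact support is entire of exponential type, so its
  Chebyshev expansion, formed from the values on the small cube of half side \<open>r\<close>, converges on the
  large cube as well. The error of the truncated expansion with noisy coefficients has two parts.

  The first is the truncation error. In one variable, the substitution \<open>t = (z + 1/z)/2\<close> splits
  \<open>exp (\<i>yt)\<close> into two exponential series, and collecting powers gives
  \<open>exp (\<i>yt) = \<Sum>\<^sub>k c\<^sub>k(y) T\<^sub>k(t)\<close> for all real \<open>t\<close> (\<open>jacobi_anger_expansion\<close>), with coefficients of size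
  at most \<open>2 exp (\<bar>y\<bar>\<rho>) z\<^sup>-\<^sup>k\<close> whenever \<open>(z + 1/z)/2 \<le> \<rho>\<close> (\<open>norm_jacobi_anger_le\<close>). On the large
  cube \<open>T\<^sub>k\<close> grows only like \<open>(2R/r)\<^sup>k\<close> (\<open>chebyshev_T_growth\<close>). The choice \<open>z = 39\<rho>/20\<close> is possible for
  \<open>\<rho> \<ge> 4\<close>. Multiplying over the \<open>d\<close> coordinates and summing over total degrees \<open>\<ge> n\<close> bounds the tail
  for \<open>exp (\<i>\<xi>\<cdot>x)\<close> by \<open>((13/3)\<^sup>d - 1) exp (r\<sigma>\<rho>) (4R/(3r\<rho>))\<^sup>n\<close> (\<open>exp_inner_expansion_tail\<close>), and
  integration against \<open>v\<close> gives the same bound for \<open>F\<close>, times \<open>N\<close> (\<open>fourier_chebyshev_tail\<close>).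

  The second is the data error. By orthogonality the coefficients of \<open>F\<close> and of \<open>w\<close> differ by at most
  \<open>\<delta>\<close> times the normalising factors \<open>2\<close> (\<open>cheb_coeff_fourier_error\<close>). Summing over total degrees
  \<open>< n\<close> and using the growth of \<open>T\<^sub>k\<close> again gives \<open>2\<^sup>d (4R/r)\<^sup>n\<^sup>-\<^sup>1 \<delta>\<close>
  (\<open>sum_power_multi_index_le\<close>).

  The degree in the theorem makes both \<open>N exp (r\<sigma>\<rho>) (4R/(3r\<rho>))\<^sup>n\<close> and \<open>(4R/r)\<^sup>n\<^sup>-\<^sup>1 \<delta>\<close> at most
  \<open>(N exp (r\<sigma>\<rho>)/\<delta>)\<^sup>\<tau> \<delta>\<close> (\<open>degree_choice\<close>), and \<open>(13/3)\<^sup>d - 1 + 2\<^sup>d \<le> (16/3)\<^sup>d\<close>. On the small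
  cube the error is at most \<open>\<delta>\<close>, because there the extension is \<open>w\<close> itself.
\<close>

section \<open>Chebyshev polynomials\<close>

text \<open>
  The defining identity on \<open>[-1,1]\<close> determines the polynomial, so an identity between Chebyshev
  polynomials only has to be checked for cosines.
\<close>

lemma chebyshev_T_eqI:
  assumes "\<And>t. t \<in> {-1..1} \<Longrightarrow> poly p t = cos (real k * arccos t)"
  shows "chebyshev_T k = p"
  using chebyshev_T_ex1[of k] poly_chebyshev_T[of _ k] assms by blast

lemma chebyshev_T_0: "chebyshev_T 0 = 1"
  by (rule chebyshev_T_eqI) simp

lemma chebyshev_T_1: "chebyshev_T (Suc 0) = [:0, 1:]"
  by (rule chebyshev_T_eqI) simp

lemma chebyshev_T_rec:
  "chebyshev_T (Suc (Suc k)) = [:0, 2:] * chebyshev_T (Suc k) - chebyshev_T k"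
proof (rule chebyshev_T_eqI)
  fix t :: real assume t: "t \<in> {-1..1}"
  have "cos (real (Suc (Suc k)) * a) = 2 * cos a * cos (real (Suc k) * a) - cos (real k * a)"
    for a :: real
    using cos_add[of "real (Suc k) * a" a] cos_diff[of "real (Suc k) * a" a]
    by (simp add: algebra_simps)
  from this[of "arccos t"] t
  show "poly ([:0, 2:] * chebyshev_T (Suc k) - chebyshev_T k) t = cos (real (Suc (Suc k)) * arccos t)"
    by (simp add: poly_chebyshev_T)
qed

lemma abs_chebyshev_T_le_1: "\<bar>t\<bar> \<le> 1 \<Longrightarrow> \<bar>poly (chebyshev_T k) t\<bar> \<le> 1"
  by (subst poly_chebyshev_T) auto

text \<open>
  The substitution \<open>t = (z + 1/z)/2\<close> extends \<open>T\<^sub>k(cos \<theta>) = cos (k\<theta>)\<close> (the case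
  \<open>z = e\<^sup>i\<^sup>\<theta>\<close>) to all \<open>t\<close>: both sides satisfy the same three-term recurrence. This gives
  the values of \<open>T\<^sub>k\<close> outside \<open>[-1,1]\<close>.
\<close>

lemma chebyshev_T_joukowski:
  fixes z :: complex
  assumes "z \<noteq> 0" and t: "of_real t = (z + 1 / z) / 2"
  shows "of_real (poly (chebyshev_T k) t) = (z ^ k + (1 / z) ^ k) / 2"
proof (induction k rule: induct_nat_012)
  case (ge2 k)
  have "complex_of_real (poly (chebyshev_T (Suc (Suc k))) t)
      = 2 * of_real t * of_real (poly (chebyshev_T (Suc k)) t) - of_real (poly (chebyshev_T k) t)"
    by (simp add: chebyshev_T_rec mult_ac)
  also have "\<dots> = (z ^ Suc (Suc k) + (1 / z) ^ Suc (Suc k)) / 2"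
    unfolding ge2 t using \<open>z \<noteq> 0\<close> by (simp add: field_simps)
  finally show ?case .
qed (use t in \<open>simp_all add: chebyshev_T_0 chebyshev_T_1\<close>)

text \<open>The numbers \<open>z\<close> and \<open>1/z\<close> are the roots of \<open>x\<^sup>2 - 2wx + 1\<close>.\<close>

lemma joukowski_preimage:
  fixes w :: complex
  obtains z where "z \<noteq> 0" and "w = (z + 1 / z) / 2"
proof -
  define z where "z = w + csqrt (w\<^sup>2 - 1)"
  have *: "z * (w - csqrt (w\<^sup>2 - 1)) = 1"
    unfolding z_def using power2_csqrt[of "w\<^sup>2 - 1"]
    by (simp add: algebra_simps power2_eq_square)
  then have "z \<noteq> 0" by auto
  with * have "1 / z = w - csqrt (w\<^sup>2 - 1)"
    by (simp add: field_simps)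
  then have "w = (z + 1 / z) / 2"
    unfolding z_def by simp
  with \<open>z \<noteq> 0\<close> show ?thesis by (rule that)
qed

lemma power_add_power_le_power_add:
  fixes a b :: real
  assumes "a \<ge> 0" "b \<ge> 0" "k > 0"
  shows "a ^ k + b ^ k \<le> (a + b) ^ k"
  using \<open>k > 0\<close>
proof (induction k rule: nat_induct_non_zero)
  case (Suc k)
  have "a ^ Suc k + b ^ Suc k \<le> (a + b) * (a ^ k + b ^ k)"
    using assms by (simp add: algebra_simps)
  also have "\<dots> \<le> (a + b) * (a + b) ^ k"
    using Suc assms by (intro mult_left_mono) auto
  finally show ?case by simp
qed simp

text \<open>
  For \<open>\<bar>t\<bar> > 1\<close> the number \<open>z\<close> with \<open>t = (z + 1/z)/2\<close> is real, and then
  \<open>2\<bar>T\<^sub>k(t)\<bar> \<le> \<bar>z\<bar>\<^sup>k + \<bar>1/z\<bar>\<^sup>k \<le> (\<bar>z\<bar> + \<bar>1/z\<bar>)\<^sup>k = (2\<bar>t\<bar>)\<^sup>k\<close>. The factor in front is the one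
  that normalises the Chebyshev coefficients, and it is absorbed at no cost.
\<close>

lemma chebyshev_T_growth:
  assumes "\<bar>t\<bar> \<le> s" and "1 \<le> s"
  shows "2 ^ of_bool (k > 0) * \<bar>poly (chebyshev_T k) t\<bar> \<le> (2 * s) ^ k"
proof (cases "k = 0")
  case False
  then have k: "k > 0" by simp
  have "2 * \<bar>poly (chebyshev_T k) t\<bar> \<le> (2 * s) ^ k"
  proof (cases "\<bar>t\<bar> \<le> 1")
    case True
    have "2 * \<bar>poly (chebyshev_T k) t\<bar> \<le> 2 * 1"
      using abs_chebyshev_T_le_1[OF True] by simp
    also have "\<dots> \<le> 2 * s" using assms by simp
    also have "\<dots> \<le> (2 * s) ^ k" using k assms by (intro self_le_power) auto
    finally show ?thesis .
  next
    case False
    define z where "z = t + sqrt (t\<^sup>2 - 1)"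
    have "1 \<le> t\<^sup>2" using False abs_le_square_iff[of 1 t] by simp
    then have *: "z * (t - sqrt (t\<^sup>2 - 1)) = 1"
      unfolding z_def by (simp add: algebra_simps power2_eq_square flip: real_sqrt_mult)
    then have z: "z \<noteq> 0" by auto
    with * have "1 / z = t - sqrt (t\<^sup>2 - 1)" by (simp add: field_simps)
    then have t: "t = (z + 1 / z) / 2" unfolding z_def by simp
    have "of_real (poly (chebyshev_T k) t) = (of_real z ^ k + (1 / of_real z) ^ k) / (2 :: complex)"
      using z by (intro chebyshev_T_joukowski) (simp_all add: t)
    also have "\<dots> = of_real ((z ^ k + (1 / z) ^ k) / 2)" by simp
    finally have "2 * poly (chebyshev_T k) t = z ^ k + (1 / z) ^ k"
      unfolding of_real_eq_iff by simp
    then have "2 * \<bar>poly (chebyshev_T k) t\<bar> = \<bar>z ^ k + (1 / z) ^ k\<bar>" by (simp add: abs_mult)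
    also have "\<dots> \<le> \<bar>z\<bar> ^ k + \<bar>1 / z\<bar> ^ k"
      by (metis abs_triangle_ineq power_abs)
    also have "\<dots> \<le> (\<bar>z\<bar> + \<bar>1 / z\<bar>) ^ k"
      using k by (intro power_add_power_le_power_add) auto
    also have "\<bar>z\<bar> + \<bar>1 / z\<bar> = 2 * \<bar>t\<bar>"
    proof (cases "z > 0")
      case False
      with z have "z < 0" and "1 / z < 0" by auto
      then show ?thesis unfolding t abs_if by argo
    next
      case True
      then have "1 / z > 0" by simp
      with True show ?thesis unfolding t abs_if by argo
    qed
    also have "(2 * \<bar>t\<bar>) ^ k \<le> (2 * s) ^ k"
      using assms by (intro power_mono) auto
    finally show ?thesis .
  qed
  with k show ?thesis by simp
qed (simp add: chebyshev_T_0)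

section \<open>The Chebyshev expansion of the exponential\<close>

text \<open>
  In terms of Bessel functions, \<open>jacobi_anger k y\<close> is \<open>\<i>\<^sup>k J\<^sub>k(y)\<close> for \<open>k = 0\<close> and twice that
  for \<open>k > 0\<close>.
\<close>

definition jacobi_anger :: "nat \<Rightarrow> real \<Rightarrow> complex" where
  "jacobi_anger k y = 2 ^ of_bool (k > 0) *
     (\<Sum>l. (\<i> * of_real y / 2) ^ (k + l) / fact (k + l) * ((\<i> * of_real y / 2) ^ l / fact l))"

lemma exp_has_sum:
  fixes x :: complex
  shows "((\<lambda>m. x ^ m / fact m) has_sum exp x) UNIV"
    and "(\<lambda>m. norm (x ^ m / fact m)) summable_on UNIV"
proof -
  have s: "summable (\<lambda>m. norm (x ^ m / fact m))"
    using summable_norm_exp[of x] by (simp add: scaleR_conv_of_real divide_inverse mult.commute)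
  have "(\<lambda>m. x ^ m / fact m) sums exp x"
    using exp_converges[of x] by (simp add: scaleR_conv_of_real divide_inverse mult.commute)
  with s show "((\<lambda>m. x ^ m / fact m) has_sum exp x) UNIV"
    by (rule norm_summable_imp_has_sum)
  show "(\<lambda>m. norm (x ^ m / fact m)) summable_on UNIV"
    using s by (simp add: summable_on_UNIV_nonneg_real_iff)
qed

lemma has_sum_times:
  fixes f g :: "nat \<Rightarrow> complex"
  assumes "(f has_sum a) UNIV" "(\<lambda>m. norm (f m)) summable_on UNIV" "(g has_sum b) UNIV" "(\<lambda>l. norm (g l)) summable_on UNIV"
  shows "((\<lambda>(m, l). f m * g l) has_sum a * b) UNIV"
    and "(\<lambda>p. norm (case p of (m, l) \<Rightarrow> f m * g l)) summable_on UNIV"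
proof -
  have s: "(\<lambda>p. norm (case p of (m, l) \<Rightarrow> f m * g l)) summable_on Sigma UNIV (\<lambda>_. UNIV)"
    unfolding Infinite_Sum.abs_summable_on_Sigma_iff
    using assms by (auto simp: norm_mult infsum_cmult_right' abs_mult intro!: summable_on_cmult_right summable_on_cmult_left)
  show "((\<lambda>(m, l). f m * g l) has_sum a * b) UNIV"
    unfolding UNIV_Times_UNIV[symmetric]
  proof (rule has_sum_SigmaI)
    show "((\<lambda>l. case (m, l) of (m, l) \<Rightarrow> f m * g l) has_sum f m * b) UNIV" for m
      using assms by (auto intro: has_sum_cmult_right)
    show "((\<lambda>m. f m * b) has_sum a * b) UNIV"
      using assms by (auto intro: has_sum_cmult_left)
    show "(\<lambda>(m, l). f m * g l) summable_on UNIV \<times> UNIV"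
      using s by (rule abs_summable_summable)
  qed
  show "(\<lambda>p. norm (case p of (m, l) \<Rightarrow> f m * g l)) summable_on UNIV"
    using s by simp
qed

text \<open>
  Substitute \<open>t = (z + 1/z)/2\<close>, so that \<open>exp (\<i> y t)\<close> is the product of the exponential series
  in \<open>z\<close> and in \<open>1/z\<close>. In the double series collect the terms with a given difference \<open>k\<close> of
  the two exponents; the pair \<open>\<plusminus>k\<close> contributes a multiple of \<open>z\<^sup>k + z\<^sup>-\<^sup>k = 2 T\<^sub>k(t)\<close>.
\<close>

lemma jacobi_anger_expansion:
  "((\<lambda>k. jacobi_anger k y * of_real (poly (chebyshev_T k) t)) has_sum exp (\<i> * of_real (y * t))) UNIV"
proof -
  obtain z where z: "z \<noteq> 0" and t: "complex_of_real t = (z + 1 / z) / 2"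
    by (rule joukowski_preimage)
  define x where "x = \<i> * of_real y / 2"
  define a where "a m = x ^ m / fact m" for m
  define P where "P = (\<lambda>(m, l). (x * z) ^ m / fact m * ((x / z) ^ l / fact l))"
  define d where "d k = (\<Sum>l. a (k + l) * a l)" for k
  note E = exp_has_sum[of "x * z"] exp_has_sum[of "x / z"]
  have sP: "(\<lambda>p. norm (P p)) summable_on UNIV"
    unfolding P_def by (rule has_sum_times(2)[OF E])
  have "(P has_sum exp (x * z) * exp (x / z)) UNIV"
    unfolding P_def by (intro has_sum_times E)
  also have "exp (x * z) * exp (x / z) = exp (\<i> * of_real (y * t))"
    unfolding exp_add[symmetric] of_real_mult t x_def by (simp add: field_simps)
  finally have P: "(P has_sum exp (\<i> * of_real (y * t))) UNIV" .

  have a: "(\<lambda>m. norm (a m)) summable_on UNIV"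
    unfolding a_def by (rule exp_has_sum)
  have d: "((\<lambda>l. a (k + l) * a l) has_sum d k) UNIV" for k
  proof -
    have "(\<lambda>p. norm (case p of (m, l) \<Rightarrow> a m * a l)) summable_on UNIV"
      using abs_summable_summable[OF a, THEN has_sum_infsum] a by (intro has_sum_times)
    then have "(\<lambda>p. norm (case p of (m, l) \<Rightarrow> a m * a l)) summable_on (\<lambda>l. (k + l, l)) ` UNIV"
      by (rule summable_on_subset) auto
    then have "(\<lambda>l. norm (a (k + l) * a l)) summable_on UNIV"
      by (subst (asm) summable_on_reindex) (auto simp: inj_on_def o_def)
    then have "(\<lambda>l. a (k + l) * a l) summable_on UNIV"
      by (rule abs_summable_summable)
    then show ?thesis
      unfolding d_def by (metis has_sum_imp_sums has_sum_infsum sums_unique)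
  qed

  \<comment> \<open>The pairs with \<open>m - l = k \<ge> 0\<close> give the powers \<open>z\<^sup>k\<close>, the remaining ones the powers of \<open>1/z\<close>.\<close>
  define U where "U = {(m, l). l \<le> (m::nat)}"
  define L where "L = {(m, l). (m::nat) < l}"
  have sPU: "P summable_on U" and sPL: "P summable_on L"
    using abs_summable_summable[OF sP] by (rule summable_on_subset; simp)+
  have up: "((\<lambda>k. d k * z ^ k) has_sum infsum P U) UNIV"
  proof (rule has_sum_SigmaD)
    have "(P has_sum infsum P U) U" using sPU by simp
    then show "((\<lambda>(k, l). P (k + l, l)) has_sum infsum P U) (Sigma UNIV (\<lambda>_. UNIV))"
      by (subst has_sum_reindex_bij_witness[where T = U and h = P and s' = "infsum P U"
            and i = "\<lambda>(m, l). (m - l, l)" and j = "\<lambda>(k, l). (k + l, l)"])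
         (auto simp: U_def)
    show "((\<lambda>l. case (k, l) of (k, l) \<Rightarrow> P (k + l, l)) has_sum d k * z ^ k) UNIV" for k
    proof -
      have "P (k + l, l) = a (k + l) * a l * z ^ k" for l
        unfolding P_def a_def using z by (simp add: power_mult_distrib power_divide power_add)
      then show ?thesis using has_sum_cmult_left[OF d[of k], of "z ^ k"] by simp
    qed
  qed
  have low: "((\<lambda>k. d (Suc k) * (1 / z) ^ Suc k) has_sum infsum P L) UNIV"
  proof (rule has_sum_SigmaD)
    have "(P has_sum infsum P L) L" using sPL by simp
    then show "((\<lambda>(k, m). P (m, Suc k + m)) has_sum infsum P L) (Sigma UNIV (\<lambda>_. UNIV))"
      by (subst has_sum_reindex_bij_witness[where T = L and h = P and s' = "infsum P L"
            and i = "\<lambda>(m, l). (l - Suc m, m)" and j = "\<lambda>(k, m). (m, Suc k + m)"])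
         (auto simp: L_def)
    show "((\<lambda>m. case (k, m) of (k, m) \<Rightarrow> P (m, Suc k + m)) has_sum d (Suc k) * (1 / z) ^ Suc k) UNIV" for k
    proof -
      have "P (m, n + m) = a (n + m) * a m * (1 / z) ^ n" for m n
        unfolding P_def a_def using z by (simp add: power_mult_distrib power_divide power_add mult_ac)
      from this[where n = "Suc k"] show ?thesis using has_sum_cmult_left[OF d[of "Suc k"], of "(1 / z) ^ Suc k"] by simp
    qed
  qed
  have "((\<lambda>k. d k * (1 / z) ^ k) has_sum infsum P L) {0<..}"
    using low by (subst has_sum_reindex_bij_witness[where T = UNIV and i = Suc and j = "\<lambda>k. k - 1"
          and h = "\<lambda>k. d (Suc k) * (1 / z) ^ Suc k" and s' = "infsum P L"]) auto
  then have "((\<lambda>k. if k > 0 then d k * (1 / z) ^ k else 0) has_sum infsum P L) UNIV"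
    by (subst has_sum_cong_neutral[where T = "{0<..}" and g = "\<lambda>k. d k * (1 / z) ^ k"]) auto
  from has_sum_add[OF up this]
  have "((\<lambda>k. d k * z ^ k + (if k > 0 then d k * (1 / z) ^ k else 0)) has_sum infsum P U + infsum P L) UNIV" .
  also have "(\<lambda>k. d k * z ^ k + (if k > 0 then d k * (1 / z) ^ k else 0))
      = (\<lambda>k. jacobi_anger k y * of_real (poly (chebyshev_T k) t))"
  proof
    fix k
    have "jacobi_anger k y = 2 ^ of_bool (k > 0) * d k"
      unfolding jacobi_anger_def d_def a_def x_def ..
    moreover have "of_real (poly (chebyshev_T k) t) = (z ^ k + (1 / z) ^ k) / 2"
      using z t by (rule chebyshev_T_joukowski)
    ultimately show "d k * z ^ k + (if k > 0 then d k * (1 / z) ^ k else 0)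
       = jacobi_anger k y * of_real (poly (chebyshev_T k) t)"
      by (auto simp: algebra_simps)
  qed
  also have "infsum P U + infsum P L = exp (\<i> * of_real (y * t))"
  proof -
    have "infsum P (U \<union> L) = infsum P U + infsum P L"
      using sPU sPL by (rule infsum_Un_disjoint) (auto simp: U_def L_def)
    moreover have "U \<union> L = UNIV" by (auto simp: U_def L_def)
    ultimately show ?thesis using P infsumI by metis
  qed
  finally show ?thesis .
qed

text \<open>
  With \<open>c = \<bar>y\<bar>/2\<close>, the factor \<open>(cz)\<^sup>k\<^sup>+\<^sup>l/(k+l)!\<close> of each term is a single term of the series of
  \<open>exp (cz)\<close>; the remaining factors \<open>(c/z)\<^sup>l/l!\<close> add up to \<open>exp (c/z)\<close>. Thus the coefficients decay
  geometrically with any ratio \<open>1/z\<close>, at the price of a constant that is exponential in \<open>z + 1/z\<close>.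
\<close>

lemma norm_jacobi_anger_le:
  assumes "z > 0"
  shows "norm (jacobi_anger k y) \<le> 2 ^ of_bool (k > 0) * exp (\<bar>y\<bar> * ((z + 1 / z) / 2)) / z ^ k"
proof -
  define x where "x = \<i> * of_real y / 2"
  define c where "c = \<bar>y\<bar> / 2"
  have x: "norm x = c" by (simp add: x_def c_def norm_mult norm_divide)
  have c: "c \<ge> 0" by (simp add: c_def)
  let ?f = "\<lambda>l. x ^ (k + l) / fact (k + l) * (x ^ l / fact l)"
  have exp_series: "(\<lambda>n. s ^ n / fact n) sums exp s" for s :: real
    using exp_converges[of s] by (simp add: divide_inverse mult.commute)
  have bound: "norm (?f l) \<le> exp (c * z) / z ^ k * ((c / z) ^ l / fact l)" for l
  proof -
    have "(c * z) ^ (k + l) / fact (k + l) = sum (\<lambda>n. (c * z) ^ n / fact n) {k + l}" by simp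
    also have "\<dots> \<le> (\<Sum>n. (c * z) ^ n / fact n)"
      using exp_series[of "c * z"] c assms by (intro sum_le_suminf) (auto simp: sums_iff)
    also have "\<dots> = exp (c * z)" using exp_series[of "c * z"] by (simp add: sums_iff)
    finally have *: "(c * z) ^ (k + l) / fact (k + l) \<le> exp (c * z)" .
    have "norm (?f l) = (c * z) ^ (k + l) / fact (k + l) * ((c / z) ^ l / fact l) / z ^ k"
      using assms by (simp add: norm_mult norm_divide norm_power x power_add power_mult_distrib power_divide)
    also have "\<dots> \<le> exp (c * z) * ((c / z) ^ l / fact l) / z ^ k"
      using * assms c by (intro divide_right_mono mult_right_mono) auto
    finally show ?thesis by (simp add: mult_ac)
  qed
  have g: "(\<lambda>l. exp (c * z) / z ^ k * ((c / z) ^ l / fact l)) sums (exp (c * z) / z ^ k * exp (c / z))"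
    by (intro sums_mult exp_series)
  then have "norm (\<Sum>l. ?f l) \<le> (\<Sum>l. exp (c * z) / z ^ k * ((c / z) ^ l / fact l))"
    by (intro norm_suminf_le bound) (simp add: sums_iff)
  also have "\<dots> = exp (\<bar>y\<bar> * ((z + 1 / z) / 2)) / z ^ k"
    using g by (simp add: sums_iff c_def field_simps flip: exp_add)
  finally have "norm (\<Sum>l. ?f l) \<le> exp (\<bar>y\<bar> * ((z + 1 / z) / 2)) / z ^ k" .
  then show ?thesis
    unfolding jacobi_anger_def x_def[symmetric] by (auto simp: norm_mult)
qed

lemma borel_measurable_jacobi_anger [measurable]: "jacobi_anger k \<in> borel_measurable borel"
  unfolding jacobi_anger_def by measurable

section \<open>The tail of the expansion in several variables\<close>

text \<open>
  Products of absolutely convergent series are used for the value of the sum only. Summability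
  is then automatic: the sum of a family that is not summable is \<open>0\<close> by convention, and the value
  found is not \<open>0\<close>.
\<close>

lemma geometric_multi_index_has_sum:
  fixes q :: real
  assumes "0 \<le> q" "q < 1"
  shows "((\<lambda>k::'d::finite \<Rightarrow> nat. q ^ (\<Sum>j\<in>UNIV. k j)) has_sum (1 / (1 - q)) ^ CARD('d)) UNIV"
proof -
  have s: "(\<lambda>m. norm (q ^ m)) summable_on UNIV" and g: "infsum (\<lambda>m. q ^ m) UNIV = 1 / (1 - q)"
  proof -
    have *: "(\<lambda>m. q ^ m) sums (1 / (1 - q))"
      using assms by (intro geometric_sums) auto
    then show "(\<lambda>m. norm (q ^ m)) summable_on UNIV"
      using assms by (simp add: summable_on_UNIV_nonneg_real_iff norm_power sums_iff)
    show "infsum (\<lambda>m. q ^ m) UNIV = 1 / (1 - q)"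
      using * assms by (intro infsumI norm_summable_imp_has_sum) (auto simp: norm_power sums_iff)
  qed
  have "infsum (\<lambda>k::'d \<Rightarrow> nat. \<Prod>j\<in>UNIV. q ^ k j) (PiE UNIV (\<lambda>_. UNIV))
      = (\<Prod>j\<in>(UNIV::'d set). infsum (\<lambda>m. q ^ m) UNIV)"
    by (rule infsum_prod_PiE_abs) (use s in simp_all)
  then have i: "infsum (\<lambda>k::'d \<Rightarrow> nat. q ^ (\<Sum>j\<in>UNIV. k j)) UNIV = (1 / (1 - q)) ^ CARD('d)"
    by (simp add: g power_sum PiE_UNIV_domain)
  moreover have "(1 / (1 - q)) ^ CARD('d) \<noteq> 0" using assms by simp
  ultimately have "(\<lambda>k::'d \<Rightarrow> nat. q ^ (\<Sum>j\<in>UNIV. k j)) summable_on UNIV"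
    using infsum_not_exists by metis
  with i show ?thesis using has_sum_infsum by metis
qed

text \<open>
  For fixed \<open>x\<close>, the Chebyshev expansion of \<open>\<xi> \<mapsto> exp (\<i> \<xi>\<cdot>x)\<close> on the cube of half side \<open>r\<close> has the
  coefficients \<open>exp_coeff r k x\<close> with respect to the basis \<open>cheb_prod r k\<close>.
\<close>

definition exp_coeff :: "real \<Rightarrow> ('d::finite \<Rightarrow> nat) \<Rightarrow> real ^ 'd \<Rightarrow> complex" where
  "exp_coeff r k x = (\<Prod>j\<in>UNIV. jacobi_anger (k j) (r * x $ j))"

definition cheb_prod :: "real \<Rightarrow> ('d::finite \<Rightarrow> nat) \<Rightarrow> real ^ 'd \<Rightarrow> real" where
  "cheb_prod r k \<xi> = (\<Prod>j\<in>UNIV. poly (chebyshev_T (k j)) (\<xi> $ j / r))"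

text \<open>
  On the cube of half side \<open>R\<close>, the term of multi-index \<open>k\<close> is at most \<open>exp (r\<sigma>\<rho>) u\<^sup>m\<close> with
  \<open>m = k\<^sub>1 + \<dots> + k\<^sub>d\<close> and \<open>u = 2R/(rz)\<close>, for every \<open>z\<close> with \<open>(z + 1/z)/2 \<le> \<rho>\<close>. The sum over
  \<open>m \<ge> n\<close> must be bounded by a multiple of the \<open>n\<close>-th power of \<open>4R/(3r\<rho>)\<close>, without a factor that is
  polynomial in \<open>n\<close> for the number of multi-indices. This works because \<open>u\<close> is smaller than that
  ratio by a fixed factor \<open>q < 1\<close>: write \<open>u\<^sup>m = (u/q)\<^sup>m q\<^sup>m\<close>, bound the first factor by
  \<open>(u/q)\<^sup>n\<close>, and sum \<open>q\<^sup>m\<close> over all multi-indices.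
\<close>

lemma exp_inner_expansion_tail:
  fixes x \<xi> :: "real ^ 'd"
  assumes r: "r > 0" "R \<ge> r" and \<rho>: "\<rho> \<ge> 4 * R / r"
    and x: "(\<Sum>j\<in>UNIV. \<bar>x $ j\<bar>) \<le> \<sigma>" and \<xi>: "\<xi> \<in> cube R" and n: "n > 0"
  shows "norm (exp (\<i> * of_real (\<xi> \<bullet> x))
           - (\<Sum>k | (\<Sum>j\<in>UNIV. k j) < n. exp_coeff r k x * of_real (cheb_prod r k \<xi>)))
         \<le> ((13 / 3) ^ CARD('d) - 1) * exp (r * \<sigma> * \<rho>) * (4 * R / r / (3 * \<rho>)) ^ n"
proof -
  define s where "s = R / r"
  \<comment> \<open>With these values \<open>(z + 1/z)/2 \<le> \<rho>\<close> holds for \<open>\<rho> \<ge> 4\<close>, \<open>u/q = 4s/(3\<rho>)\<close> and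
      \<open>1/(1 - q) = 13/3\<close>; the last number must not exceed \<open>16/3 - 1\<close>.\<close>
  define q :: real where "q = 10 / 13"
  define z where "z = 39 / 20 * \<rho>"
  define u where "u = 2 * s / z"
  have s: "s \<ge> 1" using r by (simp add: s_def)
  have \<rho>s: "\<rho> \<ge> 4 * s" using \<rho> by (simp add: s_def)
  with s have \<rho>0: "\<rho> \<ge> 4" by linarith
  have z: "z > 0" using \<rho>0 by (simp add: z_def)
  have zz: "(z + 1 / z) / 2 \<le> \<rho>"
  proof -
    have "1 / z \<le> 1 / (39 / 20 * 4)" unfolding z_def using \<rho>0 by (intro divide_left_mono) auto
    also have "\<dots> \<le> \<rho> / 20" using \<rho>0 by simp
    finally show ?thesis unfolding z_def by simp
  qed
  have u0: "u > 0" using s z by (simp add: u_def)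
  have uq: "u / q = 4 * R / r / (3 * \<rho>)" using \<rho>0 r by (simp add: u_def q_def z_def s_def)
  have uq1: "u / q \<le> 1"
  proof -
    have "4 * R / r / (3 * \<rho>) = 4 * s / (3 * \<rho>)" by (simp add: s_def)
    also have "\<dots> \<le> 1" using \<rho>s \<rho>0 by (simp add: divide_le_eq)
    finally show ?thesis unfolding uq .
  qed
  have u1: "u < 1" using uq1 by (simp add: q_def)
  define f where "f j m = jacobi_anger m (r * x $ j) * of_real (poly (chebyshev_T m) (\<xi> $ j / r))" for j m
  have fb: "norm (f j m) \<le> exp (r * \<bar>x $ j\<bar> * \<rho>) * u ^ m" for j m
  proof -
    have "\<bar>\<xi> $ j / r\<bar> \<le> s"
      using \<xi> r by (auto simp: cube_def s_def abs_le_iff divide_right_mono field_simps)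
         (smt (verit))
    then have T: "2 ^ of_bool (m > 0) * \<bar>poly (chebyshev_T m) (\<xi> $ j / r)\<bar> \<le> (2 * s) ^ m"
      using s by (rule chebyshev_T_growth)
    have "norm (f j m) \<le> (2 ^ of_bool (m > 0) * exp (\<bar>r * x $ j\<bar> * ((z + 1 / z) / 2)) / z ^ m)
          * \<bar>poly (chebyshev_T m) (\<xi> $ j / r)\<bar>"
      unfolding f_def norm_mult norm_of_real by (intro mult_right_mono norm_jacobi_anger_le z) simp
    also have "\<dots> = exp (\<bar>r * x $ j\<bar> * ((z + 1 / z) / 2)) *
          (2 ^ of_bool (m > 0) * \<bar>poly (chebyshev_T m) (\<xi> $ j / r)\<bar>) / z ^ m"
      by simp
    also have "\<dots> \<le> exp (\<bar>r * x $ j\<bar> * \<rho>) * (2 * s) ^ m / z ^ m"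
      using T mult_left_mono[OF zz, of "\<bar>r * x $ j\<bar>"] z
      by (intro divide_right_mono mult_mono) (auto simp only: exp_le_cancel_iff exp_ge_zero, simp_all)
    also have "\<dots> = exp (r * \<bar>x $ j\<bar> * \<rho>) * u ^ m"
      using r by (simp add: u_def power_divide abs_mult)
    finally show ?thesis .
  qed
  have f_abs: "(\<lambda>m. norm (f j m)) summable_on UNIV" for j
  proof (rule summable_on_comparison_test)
    have "summable (\<lambda>m. u ^ m)" using u0 u1 by (intro summable_geometric) auto
    then have "(\<lambda>m. u ^ m) summable_on UNIV"
      using u0 by (simp add: summable_on_UNIV_nonneg_real_iff)
    then show "(\<lambda>m. exp (r * \<bar>x $ j\<bar> * \<rho>) * u ^ m) summable_on UNIV"
      by (rule summable_on_cmult_right)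
  qed (use fb in auto)
  define G where "G k = (\<Prod>j\<in>UNIV. f j (k j))" for k
  have G: "(G has_sum exp (\<i> * of_real (\<xi> \<bullet> x))) UNIV"
  proof -
    have "infsum (f j) UNIV = exp (\<i> * of_real (\<xi> $ j * x $ j))" for j
      using infsumI[OF jacobi_anger_expansion[of "r * x $ j" "\<xi> $ j / r"]] r
      unfolding f_def by (simp add: mult.commute)
    moreover have "infsum (\<lambda>k. \<Prod>j\<in>UNIV. f j (k j)) (PiE UNIV (\<lambda>_. UNIV)) = (\<Prod>j\<in>UNIV. infsum (f j) UNIV)"
      by (rule infsum_prod_PiE_abs) (use f_abs in simp_all)
    ultimately have i: "infsum G UNIV = exp (\<i> * of_real (\<xi> \<bullet> x))"
      unfolding G_def by (simp add: PiE_UNIV_domain exp_sum inner_vec_def sum_distrib_left)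
    moreover have "exp (\<i> * of_real (\<xi> \<bullet> x)) \<noteq> 0" by simp
    ultimately have "G summable_on UNIV" using infsum_not_exists by metis
    with i show ?thesis using has_sum_infsum by metis
  qed
  define F where "F = {k::'d \<Rightarrow> nat. (\<Sum>j\<in>UNIV. k j) < n}"
  have finF: "finite F" unfolding F_def by (rule finite_multi_indices)
  have "(G has_sum exp (\<i> * of_real (\<xi> \<bullet> x)) - sum G F) (UNIV - F)"
    using G finF by (intro has_sum_Diff) auto
  moreover have "((\<lambda>k. exp (r * \<sigma> * \<rho>) * (u / q) ^ n * q ^ (\<Sum>j\<in>UNIV. k j)) has_sum
      exp (r * \<sigma> * \<rho>) * (u / q) ^ n * ((1 / (1 - q)) ^ CARD('d) - (\<Sum>k\<in>F. q ^ (\<Sum>j\<in>UNIV. k j)))) (UNIV - F)"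
    using finF by (intro has_sum_cmult_right has_sum_Diff geometric_multi_index_has_sum) (auto simp: q_def)
  moreover have "norm (G k) \<le> exp (r * \<sigma> * \<rho>) * (u / q) ^ n * q ^ (\<Sum>j\<in>UNIV. k j)" if "k \<in> UNIV - F" for k
  proof -
    let ?m = "\<Sum>j\<in>UNIV. k j"
    have m: "?m \<ge> n" using that by (simp add: F_def)
    have "norm (G k) \<le> (\<Prod>j\<in>UNIV. exp (r * \<bar>x $ j\<bar> * \<rho>) * u ^ k j)"
      unfolding G_def prod_norm[symmetric] by (intro prod_mono) (use fb in auto)
    also have "\<dots> = exp (r * (\<Sum>j\<in>UNIV. \<bar>x $ j\<bar>) * \<rho>) * u ^ ?m"
      by (simp add: prod.distrib exp_sum power_sum sum_distrib_left sum_distrib_right)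
    also have "\<dots> \<le> exp (r * \<sigma> * \<rho>) * u ^ ?m"
      using x r \<rho>0 u0 by (intro mult_right_mono) auto
    also have "u ^ ?m = (u / q) ^ ?m * q ^ ?m"
      by (simp add: q_def flip: power_mult_distrib)
    also have "\<dots> \<le> (u / q) ^ n * q ^ ?m"
      using uq1 u0 m by (intro mult_right_mono power_decreasing) (auto simp: q_def)
    finally show ?thesis by (simp add: mult_ac)
  qed
  ultimately have "norm (exp (\<i> * of_real (\<xi> \<bullet> x)) - sum G F)
      \<le> exp (r * \<sigma> * \<rho>) * (u / q) ^ n * ((1 / (1 - q)) ^ CARD('d) - (\<Sum>k\<in>F. q ^ (\<Sum>j\<in>UNIV. k j)))"
    by (rule norm_infsum_le)
  \<comment> \<open>The zero multi-index is not in the tail. The resulting \<open>-1\<close> is what makes the constant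
      \<open>(16/3)\<^sup>d\<close> suffice when \<open>d = 1\<close>.\<close>
  also have "\<dots> \<le> exp (r * \<sigma> * \<rho>) * (u / q) ^ n * ((1 / (1 - q)) ^ CARD('d) - 1)"
  proof -
    have "(\<Sum>k\<in>({\<lambda>_. 0} :: ('d \<Rightarrow> nat) set). q ^ (\<Sum>j\<in>UNIV. k j)) \<le> (\<Sum>k\<in>F. q ^ (\<Sum>j\<in>UNIV. k j))"
      using finF n by (intro sum_mono2) (auto simp: F_def q_def)
    then show ?thesis using u0 by (intro mult_left_mono) (auto simp: q_def)
  qed
  also have "\<dots> = ((13 / 3) ^ CARD('d) - 1) * exp (r * \<sigma> * \<rho>) * (4 * R / r / (3 * \<rho>)) ^ n"
    unfolding uq by (simp add: q_def)
  finally show ?thesis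
    unfolding G_def F_def f_def exp_coeff_def cheb_prod_def prod.distrib of_real_prod .
qed

section \<open>Orthogonality and the coefficient functional\<close>

lemma norm_integral_le_AE:
  fixes f :: "'a \<Rightarrow> complex"
  assumes f: "f \<in> borel_measurable M" and g: "integrable M g" and le: "AE x in M. norm (f x) \<le> g x"
  shows "integrable M f" and "norm (integral\<^sup>L M f) \<le> integral\<^sup>L M g"
proof -
  show i: "integrable M f"
    by (rule Bochner_Integration.integrable_bound[OF g f]) (use le in auto)
  have "norm (integral\<^sup>L M f) \<le> (\<integral>x. norm (f x) \<partial>M)"
    by (rule integral_norm_bound)
  also have "\<dots> \<le> integral\<^sup>L M g"
    using i g le by (intro integral_mono_AE) auto
  finally show "norm (integral\<^sup>L M f) \<le> integral\<^sup>L M g" .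
qed

text \<open>
  This is the substitution \<open>s = r cos \<theta>\<close> in the form of an antiderivative: a primitive of
  \<open>cos (k\<theta>)\<close>, composed with \<open>\<theta> = arccos (s/r)\<close>. It is continuous up to the end points, where the
  integrand has its singularities.
\<close>

lemma cheb_has_integral:
  assumes r: "r > 0"
  shows "((\<lambda>s. poly (chebyshev_T k) (s / r) / sqrt (r\<^sup>2 - s\<^sup>2)) has_integral (if k = 0 then pi else 0)) {-r..r}"
proof -
  define G where "G \<theta> = (if k = 0 then - \<theta> else - sin (real k * \<theta>) / real k)" for \<theta>
  have "((\<lambda>s. poly (chebyshev_T k) (s / r) / sqrt (r\<^sup>2 - s\<^sup>2)) has_integral
           (G (arccos (r / r)) - G (arccos (- r / r)))) {-r..r}"
  proof (rule fundamental_theorem_of_calculus_interior)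
    show "continuous_on {-r..r} (\<lambda>s. G (arccos (s / r)))"
      unfolding G_def using r
      by (cases "k = 0") (auto intro!: continuous_intros simp: le_divide_eq divide_le_eq)
    fix s assume s: "s \<in> {-r<..<r}"
    have s1: "-1 < s / r" "s / r < 1" using s r by (auto simp: field_simps)
    have sq: "r * sqrt (1 - (s / r)\<^sup>2) = sqrt (r\<^sup>2 - s\<^sup>2)"
    proof -
      have "r * sqrt (1 - (s / r)\<^sup>2) = sqrt (r\<^sup>2 * (1 - (s / r)\<^sup>2))"
        using r by (simp add: real_sqrt_mult)
      also have "r\<^sup>2 * (1 - (s / r)\<^sup>2) = r\<^sup>2 - s\<^sup>2" using r by (simp add: field_simps)
      finally show ?thesis .
    qed
    have A: "((\<lambda>s. arccos (s / r)) has_real_derivative - (1 / sqrt (r\<^sup>2 - s\<^sup>2))) (at s)"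
      using DERIV_chain2[OF DERIV_arccos[OF s1] DERIV_cdivide[OF DERIV_ident, of r]]
      by (simp add: sq[symmetric] field_simps)
    have B: "(G has_real_derivative - cos (real k * arccos (s / r))) (at (arccos (s / r)))"
    proof (cases "k = 0")
      case False
      then show ?thesis unfolding G_def by (auto intro!: derivative_eq_intros)
    next
      case True
      then have "G = (\<lambda>\<theta>. - \<theta>)" by (auto simp: G_def)
      with True show ?thesis by (auto intro!: derivative_eq_intros)
    qed
    have "poly (chebyshev_T k) (s / r) = cos (real k * arccos (s / r))"
      using s1 by (intro poly_chebyshev_T) auto
    with DERIV_chain2[OF B A]
    show "((\<lambda>s. G (arccos (s / r))) has_vector_derivative poly (chebyshev_T k) (s / r) / sqrt (r\<^sup>2 - s\<^sup>2)) (at s)"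
      by (simp add: has_real_derivative_iff_has_vector_derivative)
  qed (use r in simp)
  also have "G (arccos (r / r)) - G (arccos (- r / r)) = (if k = 0 then pi else 0)"
    using r by (simp add: G_def)
  finally show ?thesis .
qed

text \<open>
  The indicator function is part of the weight, so that integrals over the cube become
  integrals of products of functions of one variable over the whole space.
\<close>

definition cheb_weight :: "real \<Rightarrow> nat \<Rightarrow> real \<Rightarrow> real" where
  "cheb_weight r k s = indicator {-r..r} s *
     (2 ^ of_bool (k > 0) * poly (chebyshev_T k) (s / r) / (pi * sqrt (r\<^sup>2 - s\<^sup>2)))"

lemma borel_measurable_poly [measurable]: "poly (p :: real poly) \<in> borel_measurable borel"
  by (intro borel_measurable_continuous_onI continuous_intros)

lemma borel_measurable_cheb_weight [measurable]: "cheb_weight r k \<in> borel_measurable borel"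
  unfolding cheb_weight_def by measurable

lemma cheb_weight_0_integral:
  assumes r: "r > 0"
  shows "integrable lborel (cheb_weight r 0)" and "integral\<^sup>L lborel (cheb_weight r 0) = 1"
proof -
  have "((\<lambda>s. 1 / pi * (poly (chebyshev_T 0) (s / r) / sqrt (r\<^sup>2 - s\<^sup>2))) has_integral 1 / pi * pi) {-r..r}"
    using has_integral_mult_right[OF cheb_has_integral[OF r, of 0], of "1 / pi"]
    by (simp only: simp_thms if_True)
  then have "((\<lambda>s. if s \<in> {-r..r} then 1 / pi * (poly (chebyshev_T 0) (s / r) / sqrt (r\<^sup>2 - s\<^sup>2)) else 0)
      has_integral 1 / pi * pi) UNIV"
    by (simp only: has_integral_restrict_UNIV)
  also have "(\<lambda>s. if s \<in> {-r..r} then 1 / pi * (poly (chebyshev_T 0) (s / r) / sqrt (r\<^sup>2 - s\<^sup>2)) else 0)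
      = cheb_weight r 0"
    by (auto simp: cheb_weight_def fun_eq_iff)
  finally have h: "(cheb_weight r 0 has_integral 1) UNIV" by simp
  have nn: "cheb_weight r 0 s \<ge> 0" for s
  proof (cases "s \<in> {-r..r}")
    case True
    then have "\<bar>s\<bar> \<le> \<bar>r\<bar>" using r by auto
    then have "s\<^sup>2 \<le> r\<^sup>2" by (simp add: abs_le_square_iff)
    then show ?thesis by (simp add: cheb_weight_def chebyshev_T_0)
  qed (simp add: cheb_weight_def)
  have "(\<integral>\<^sup>+ s. ennreal (cheb_weight r 0 s) \<partial>lborel) = ennreal 1"
    using nn h by (intro nn_integral_has_integral_lborel) auto
  then have "has_bochner_integral lborel (cheb_weight r 0) 1"
    using nn by (intro has_bochner_integral_nn_integral) auto
  then show "integrable lborel (cheb_weight r 0)" and "integral\<^sup>L lborel (cheb_weight r 0) = 1"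
    by (auto simp: has_bochner_integral_iff)
qed

lemma abs_cheb_weight_le:
  assumes "r > 0"
  shows "\<bar>cheb_weight r k s\<bar> \<le> 2 ^ of_bool (k > 0) * cheb_weight r 0 s"
proof (cases "s \<in> {-r..r}")
  case True
  then have "\<bar>s\<bar> \<le> \<bar>r\<bar>" using assms by auto
  then have "s\<^sup>2 \<le> r\<^sup>2" by (simp add: abs_le_square_iff)
  moreover have "\<bar>poly (chebyshev_T k) (s / r)\<bar> \<le> 1"
    using True assms by (intro abs_chebyshev_T_le_1) (auto simp: abs_le_iff field_simps)
  ultimately have "2 ^ of_bool (k > 0) * \<bar>poly (chebyshev_T k) (s / r)\<bar> / (pi * sqrt (r\<^sup>2 - s\<^sup>2))
       \<le> 2 ^ of_bool (k > 0) * 1 / (pi * sqrt (r\<^sup>2 - s\<^sup>2))"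
    by (intro divide_right_mono mult_left_mono) auto
  with True \<open>s\<^sup>2 \<le> r\<^sup>2\<close> show ?thesis
    by (simp add: cheb_weight_def chebyshev_T_0 abs_mult)
qed (simp add: cheb_weight_def)

lemma cheb_weight_integrable:
  assumes r: "r > 0"
  shows "integrable lborel (cheb_weight r k)"
proof (rule Bochner_Integration.integrable_bound)
  show "integrable lborel (\<lambda>s. 2 ^ of_bool (k > 0) * cheb_weight r 0 s)"
    using cheb_weight_0_integral[OF r] by simp
  show "AE s in lborel. norm (cheb_weight r k s) \<le> norm (2 ^ of_bool (k > 0) * cheb_weight r 0 s)"
    using order_trans[OF abs_cheb_weight_le[OF r] abs_ge_self] by (intro AE_I2) (simp only: real_norm_def)
qed measurable

text \<open>By \<open>2 T\<^sub>m T\<^sub>k = T\<^bsub>\<bar>m-k\<bar>\<^esub> + T\<^bsub>m+k\<^esub>\<close>, only indices with \<open>m = k\<close> leave a term \<open>T\<^sub>0\<close>.\<close>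

lemma cheb_weight_orthogonal:
  assumes r: "r > 0"
  shows "integrable lborel (\<lambda>s. poly (chebyshev_T m) (s / r) * cheb_weight r k s)"
    and "(\<integral>s. poly (chebyshev_T m) (s / r) * cheb_weight r k s \<partial>lborel) = of_bool (m = k)"
proof -
  let ?f = "\<lambda>s. poly (chebyshev_T m) (s / r) * cheb_weight r k s"
  show int: "integrable lborel ?f"
  proof (rule Bochner_Integration.integrable_bound)
    show "integrable lborel (cheb_weight r k)" using r by (rule cheb_weight_integrable)
    have "\<bar>poly (chebyshev_T m) (s / r)\<bar> * \<bar>cheb_weight r k s\<bar> \<le> \<bar>cheb_weight r k s\<bar>" for s
    proof (cases "s \<in> {-r..r}")
      case True
      then have "\<bar>poly (chebyshev_T m) (s / r)\<bar> \<le> 1"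
        using r by (intro abs_chebyshev_T_le_1) (auto simp: abs_le_iff field_simps)
      then show ?thesis by (simp add: mult_left_le_one_le)
    qed (simp add: cheb_weight_def)
    then show "AE s in lborel. norm (?f s) \<le> norm (cheb_weight r k s)" by (simp add: abs_mult)
  qed measurable
  let ?c = "2 ^ of_bool (k > 0) / pi / 2 :: real"
  let ?d = "if k \<le> m then m - k else k - m"
  let ?T = "\<lambda>i s. poly (chebyshev_T i) (s / r) / sqrt (r\<^sup>2 - s\<^sup>2)"
  let ?I = "\<lambda>i. if i = 0 then pi else 0 :: real"
  have "((\<lambda>s. ?c * (?T ?d s + ?T (m + k) s)) has_integral ?c * (?I ?d + ?I (m + k))) {-r..r}"
    by (intro has_integral_mult_right has_integral_add cheb_has_integral r)
  then have "((\<lambda>s. if s \<in> {-r..r} then ?c * (?T ?d s + ?T (m + k) s) else 0) has_integral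
      ?c * (?I ?d + ?I (m + k))) UNIV"
    by (simp only: has_integral_restrict_UNIV)
  also have "(\<lambda>s. if s \<in> {-r..r} then ?c * (?T ?d s + ?T (m + k) s) else 0) = ?f"
  proof
    fix s
    show "(if s \<in> {-r..r} then ?c * (?T ?d s + ?T (m + k) s) else 0) = ?f s"
    proof (cases "s \<in> {-r..r}")
      case True
      then have s: "s / r \<in> {-1..1}" using r by (auto simp: field_simps)
      let ?a = "arccos (s / r)"
      have "cos (real ?d * ?a) = cos (real m * ?a - real k * ?a)"
        using cos_minus[of "real m * ?a - real k * ?a"]
        by (auto simp: of_nat_diff algebra_simps)
      then have "poly (chebyshev_T m) (s / r) * poly (chebyshev_T k) (s / r)
          = (poly (chebyshev_T ?d) (s / r) + poly (chebyshev_T (m + k)) (s / r)) / 2"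
        unfolding poly_chebyshev_T[OF s] cos_times_cos by (simp add: algebra_simps)
      then have *: "poly (chebyshev_T ?d) (s / r) + poly (chebyshev_T (m + k)) (s / r)
          = 2 * (poly (chebyshev_T m) (s / r) * poly (chebyshev_T k) (s / r))" by simp
      show ?thesis
        using True unfolding add_divide_distrib[symmetric] * cheb_weight_def by simp
    qed (auto simp: cheb_weight_def)
  qed
  also have "?c * (?I ?d + ?I (m + k)) = of_bool (m = k)"
    by auto
  finally have "(?f has_integral of_bool (m = k)) UNIV" .
  with has_integral_integral_lborel[OF int] show "integral\<^sup>L lborel ?f = of_bool (m = k)"
    by (rule has_integral_unique)
qed

lemma lebesgue_integral_prod_components:
  fixes h :: "'d::finite \<Rightarrow> real \<Rightarrow> real"
  assumes h: "\<And>j. integrable lborel (h j)"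
  shows "integrable lebesgue (\<lambda>x::real^'d. \<Prod>j\<in>UNIV. h j (x $ j))"
    and "(\<integral>x. (\<Prod>j\<in>UNIV. h j ((x :: real^'d) $ j)) \<partial>lebesgue) = (\<Prod>j\<in>UNIV. integral\<^sup>L lborel (h j))"
proof -
  have h_meas [measurable]: "h j \<in> borel_measurable borel" for j
    using borel_measurable_integrable[OF h[of j]] by simp
  have meas: "(\<lambda>x::real^'d. \<Prod>j\<in>UNIV. h j (x $ j)) \<in> borel_measurable borel"
    by (intro borel_measurable_prod measurable_compose[OF _ h_meas] borel_measurable_continuous_onI
        continuous_intros)
  define g where "g b = h (SOME j. b = axis j (1::real))" for b
  have g: "g (axis j 1) = h j" for j by (simp add: g_def axis_eq_axis)
  have Bas: "(\<Prod>b\<in>Basis. F b) = (\<Prod>j\<in>UNIV. F (axis j (1::real)))" for F :: "real^'d \<Rightarrow> real"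
  proof -
    have B: "(Basis :: (real^'d) set) = (\<lambda>j::'d. axis j (1::real)) ` UNIV" by (auto simp: Basis_vec_def)
    have I: "inj (\<lambda>j::'d. axis j (1::real))" by (auto simp: inj_on_def axis_eq_axis)
    show ?thesis unfolding B prod.reindex[OF I] o_def ..
  qed
  have gi: "integrable lborel (g b)" if "b \<in> Basis" for b :: "real^'d"
    using that h by (auto simp: Basis_vec_def g)
  interpret product_sigma_finite "\<lambda>_::real^'d. lborel :: real measure" ..
  have T: "(\<lambda>f. \<Sum>b\<in>Basis. f b *\<^sub>R b) \<in> (\<Pi>\<^sub>M b\<in>(Basis :: (real^'d) set). lborel) \<rightarrow>\<^sub>M borel"
    by measurable
  have eq: "(\<Prod>j\<in>UNIV. h j ((\<Sum>b\<in>Basis. f b *\<^sub>R b) $ j)) = (\<Prod>b\<in>Basis. g b (f b))" for f :: "real^'d \<Rightarrow> real"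
  proof -
    have "(\<Sum>b\<in>Basis. f b *\<^sub>R b) $ j = f (axis j 1)" for j
    proof -
      have "axis j (1::real) \<in> Basis" by (auto simp: Basis_vec_def)
      then show ?thesis unfolding cart_eq_inner_axis by (rule inner_sum_left_Basis)
    qed
    then show ?thesis by (simp add: Bas g)
  qed
  have "integrable lborel (\<lambda>x::real^'d. \<Prod>j\<in>UNIV. h j (x $ j))"
    unfolding lborel_eq[where 'a = "real^'d"] by (subst integrable_distr_eq[OF T meas])
      (simp only: eq, rule product_integrable_prod, simp_all add: gi)
  then show "integrable lebesgue (\<lambda>x::real^'d. \<Prod>j\<in>UNIV. h j (x $ j))"
    using meas by (subst integrable_completion) auto
  have "(\<integral>x. (\<Prod>j\<in>UNIV. h j ((x :: real^'d) $ j)) \<partial>lborel) = (\<Prod>b\<in>Basis. integral\<^sup>L lborel (g b))"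
    unfolding lborel_eq[where 'a = "real^'d"] by (subst integral_distr[OF T meas])
      (simp only: eq, rule product_integral_prod, simp_all add: gi)
  then show "(\<integral>x. (\<Prod>j\<in>UNIV. h j ((x :: real^'d) $ j)) \<partial>lebesgue) = (\<Prod>j\<in>UNIV. integral\<^sup>L lborel (h j))"
    using meas by (subst integral_completion) (auto simp: Bas g)
qed

definition cheb_kernel :: "real \<Rightarrow> ('d::finite \<Rightarrow> nat) \<Rightarrow> real ^ 'd \<Rightarrow> real" where
  "cheb_kernel r k \<xi> = (\<Prod>j\<in>UNIV. cheb_weight r (k j) (\<xi> $ j))"

lemma cheb_kernel_eq:
  "cheb_kernel r k \<xi> = indicator (cube r) \<xi> *
     (\<Prod>j\<in>UNIV. 2 ^ of_bool (k j > 0) * poly (chebyshev_T (k j)) (\<xi> $ j / r) /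
                        (pi * sqrt (r\<^sup>2 - (\<xi> $ j)\<^sup>2)))"
proof -
  have "indicator (cube r) \<xi> = (\<Prod>j\<in>UNIV. indicator {-r..r} (\<xi> $ j) :: real)"
    by (cases "\<xi> \<in> cube r") (auto simp: cube_def indicator_def intro!: prod_zero[symmetric])
  then show ?thesis
    unfolding cheb_kernel_def cheb_weight_def prod.distrib by simp
qed

lemma cheb_coeff_eq: "cheb_coeff r w k = (\<integral>\<xi>. w \<xi> * of_real (cheb_kernel r k \<xi>) \<partial>lebesgue)"
  unfolding cheb_coeff_def set_lebesgue_integral_def cheb_kernel_eq
  by (simp add: scaleR_conv_of_real mult_ac)

lemma cheb_kernel_integrable: "r > 0 \<Longrightarrow> integrable lebesgue (cheb_kernel r k)"
  unfolding cheb_kernel_def by (intro lebesgue_integral_prod_components cheb_weight_integrable)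

lemma cheb_kernel_norm_integral:
  assumes r: "r > 0"
  shows "(\<integral>\<xi>. \<bar>cheb_kernel r k \<xi>\<bar> \<partial>lebesgue) \<le> (\<Prod>j\<in>UNIV. 2 ^ of_bool (k j > 0))"
proof -
  have "integral\<^sup>L lborel (\<lambda>s. \<bar>cheb_weight r (k j) s\<bar>) \<le> 2 ^ of_bool (k j > 0)" for j
  proof -
    have "integral\<^sup>L lborel (\<lambda>s. \<bar>cheb_weight r (k j) s\<bar>) \<le> integral\<^sup>L lborel (\<lambda>s. 2 ^ of_bool (k j > 0) * cheb_weight r 0 s)"
      using r by (intro integral_mono integrable_abs cheb_weight_integrable abs_cheb_weight_le) (auto intro!: cheb_weight_integrable)
    then show ?thesis using cheb_weight_0_integral[OF r] by simp
  qed
  then have "(\<Prod>j\<in>UNIV. integral\<^sup>L lborel (\<lambda>s. \<bar>cheb_weight r (k j) s\<bar>)) \<le> (\<Prod>j\<in>UNIV. 2 ^ of_bool (k j > 0))"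
    by (intro prod_mono) auto
  then show ?thesis
    unfolding cheb_kernel_def abs_prod
    by (subst lebesgue_integral_prod_components) (use r in \<open>auto intro!: cheb_weight_integrable\<close>)
qed

lemma cheb_prod_orthogonal:
  assumes r: "r > 0"
  shows "integrable lebesgue (\<lambda>\<xi>. cheb_prod r m \<xi> * cheb_kernel r k \<xi>)"
    and "(\<integral>\<xi>. cheb_prod r m \<xi> * cheb_kernel r k \<xi> \<partial>lebesgue) = of_bool (m = k)"
proof -
  have e: "(\<lambda>\<xi>. cheb_prod r m \<xi> * cheb_kernel r k \<xi>)
      = (\<lambda>\<xi>. \<Prod>j\<in>UNIV. poly (chebyshev_T (m j)) (\<xi> $ j / r) * cheb_weight r (k j) (\<xi> $ j))"
    by (simp add: cheb_prod_def cheb_kernel_def prod.distrib)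
  show "integrable lebesgue (\<lambda>\<xi>. cheb_prod r m \<xi> * cheb_kernel r k \<xi>)"
    unfolding e using cheb_weight_orthogonal[OF r] by (intro lebesgue_integral_prod_components)
  have "(\<integral>\<xi>. cheb_prod r m \<xi> * cheb_kernel r k \<xi> \<partial>lebesgue) = (\<Prod>j\<in>UNIV. of_bool (m j = k j))"
    unfolding e using cheb_weight_orthogonal[OF r] by (subst lebesgue_integral_prod_components) auto
  also have "\<dots> = of_bool (m = k)"
    by (auto simp: fun_eq_iff)
  finally show "(\<integral>\<xi>. cheb_prod r m \<xi> * cheb_kernel r k \<xi> \<partial>lebesgue) = of_bool (m = k)" .
qed

lemma cube_closed: "closed (cube r :: (real^'d) set)"
proof -
  have "cube r = (\<Inter>j. {\<xi> :: real^'d. -r \<le> \<xi> $ j \<and> \<xi> $ j \<le> r})" by (auto simp: cube_def)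
  moreover have "closed {\<xi> :: real^'d. -r \<le> \<xi> $ j \<and> \<xi> $ j \<le> r}" for j
    by (intro closed_Collect_conj closed_Collect_le continuous_intros)
  ultimately show ?thesis by auto
qed

lemma cube_measurable [measurable]: "cube r \<in> sets lebesgue"
  using borel_closed[OF cube_closed] by (intro sets_completionI_sets) simp

text \<open>
  The coefficient functionals are bounded for the supremum norm, since the Chebyshev weight
  \<open>1/(\<pi>(r\<^sup>2 - s\<^sup>2)\<^sup>1\<^sup>/\<^sup>2)\<close> is a probability density and \<open>\<bar>T\<^sub>k\<bar> \<le> 1\<close> on \<open>[-1,1]\<close>.
\<close>

lemma cheb_coeff_bound:
  assumes r: "r > 0" and h: "h \<in> borel_measurable (lebesgue_on (cube r))"
    and le: "AE \<xi> in lebesgue_on (cube r). norm (h \<xi>) \<le> \<epsilon>" and \<epsilon>: "\<epsilon> \<ge> 0"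
  shows "integrable lebesgue (\<lambda>\<xi>. h \<xi> * of_real (cheb_kernel r k \<xi>))"
    and "norm (cheb_coeff r h k) \<le> \<epsilon> * (\<Prod>j\<in>UNIV. 2 ^ of_bool (k j > 0))"
proof -
  have km [measurable]: "cheb_kernel r k \<in> borel_measurable lebesgue"
    using cheb_kernel_integrable[OF r] by (rule borel_measurable_integrable)
  have "(\<lambda>\<xi>. indicator (cube r) \<xi> *\<^sub>R h \<xi>) \<in> borel_measurable lebesgue"
    using h by (subst (asm) borel_measurable_restrict_space_iff) auto
  then have "(\<lambda>\<xi>. indicator (cube r) \<xi> *\<^sub>R h \<xi> * of_real (cheb_kernel r k \<xi>)) \<in> borel_measurable lebesgue"
    by measurable
  also have "(\<lambda>\<xi>. indicator (cube r) \<xi> *\<^sub>R h \<xi> * of_real (cheb_kernel r k \<xi>))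
      = (\<lambda>\<xi>. h \<xi> * of_real (cheb_kernel r k \<xi>))"
    by (auto simp: fun_eq_iff cheb_kernel_eq indicator_def)
  finally have m: "(\<lambda>\<xi>. h \<xi> * of_real (cheb_kernel r k \<xi>)) \<in> borel_measurable lebesgue" .
  have "AE \<xi> in lebesgue. \<xi> \<in> cube r \<longrightarrow> norm (h \<xi>) \<le> \<epsilon>"
    using le by (subst (asm) AE_restrict_space_iff) auto
  then have b: "AE \<xi> in lebesgue. norm (h \<xi> * of_real (cheb_kernel r k \<xi>)) \<le> \<epsilon> * \<bar>cheb_kernel r k \<xi>\<bar>"
  proof (rule AE_mp, intro AE_I2 impI)
    fix \<xi> assume *: "\<xi> \<in> cube r \<longrightarrow> norm (h \<xi>) \<le> \<epsilon>"
    show "norm (h \<xi> * of_real (cheb_kernel r k \<xi>)) \<le> \<epsilon> * \<bar>cheb_kernel r k \<xi>\<bar>"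
    proof (cases "\<xi> \<in> cube r")
      case True
      with * show ?thesis by (simp only: norm_mult norm_of_real mult_right_mono abs_ge_zero)
    qed (simp add: cheb_kernel_eq)
  qed
  have ki: "integrable lebesgue (\<lambda>\<xi>. \<epsilon> * \<bar>cheb_kernel r k \<xi>\<bar>)"
    using cheb_kernel_integrable[OF r] by auto
  show "integrable lebesgue (\<lambda>\<xi>. h \<xi> * of_real (cheb_kernel r k \<xi>))"
    using m ki b by (rule norm_integral_le_AE)
  have "norm (cheb_coeff r h k) \<le> (\<integral>\<xi>. \<epsilon> * \<bar>cheb_kernel r k \<xi>\<bar> \<partial>lebesgue)"
    unfolding cheb_coeff_eq using m ki b by (rule norm_integral_le_AE)
  also have "\<dots> \<le> \<epsilon> * (\<Prod>j\<in>UNIV. 2 ^ of_bool (k j > 0))"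
    using cheb_kernel_norm_integral[OF r, of k] \<epsilon> by (simp add: mult_left_mono)
  finally show "norm (cheb_coeff r h k) \<le> \<epsilon> * (\<Prod>j\<in>UNIV. 2 ^ of_bool (k j > 0))" .
qed

text \<open>
  Orthogonality recovers the coefficients of a finite Chebyshev sum exactly, and the difference
  from that sum is controlled by the bound on the coefficient functionals.
\<close>

lemma cheb_coeff_near_polynomial:
  assumes r: "r > 0" and S: "finite S" "k \<in> S"
    and p: "\<And>\<xi>. p \<xi> = (\<Sum>m\<in>S. b m * of_real (cheb_prod r m \<xi>))"
    and h: "(\<lambda>\<xi>. w \<xi> - p \<xi>) \<in> borel_measurable (lebesgue_on (cube r))"
    and le: "AE \<xi> in lebesgue_on (cube r). norm (w \<xi> - p \<xi>) \<le> \<epsilon>" and \<epsilon>: "\<epsilon> \<ge> 0"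
  shows "norm (cheb_coeff r w k - b k) \<le> \<epsilon> * (\<Prod>j\<in>UNIV. 2 ^ of_bool (k j > 0))"
proof -
  have i1: "integrable lebesgue (\<lambda>\<xi>. (w \<xi> - p \<xi>) * of_real (cheb_kernel r k \<xi>))"
    by (rule cheb_coeff_bound[OF r h le \<epsilon>])
  have i3: "integrable lebesgue (\<lambda>\<xi>. complex_of_real (cheb_prod r m \<xi> * cheb_kernel r k \<xi>))" for m
    by (intro integrable_of_real cheb_prod_orthogonal r)
  have pe: "p \<xi> * of_real (cheb_kernel r k \<xi>)
      = (\<Sum>m\<in>S. b m * complex_of_real (cheb_prod r m \<xi> * cheb_kernel r k \<xi>))" for \<xi>
    by (simp add: p sum_distrib_right mult.assoc)
  have i2: "integrable lebesgue (\<lambda>\<xi>. p \<xi> * of_real (cheb_kernel r k \<xi>))"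
    unfolding pe by (intro Bochner_Integration.integrable_sum integrable_mult_right i3)
  have "(\<integral>\<xi>. b m * complex_of_real (cheb_prod r m \<xi> * cheb_kernel r k \<xi>) \<partial>lebesgue)
      = (if m = k then b k else 0)" for m
    unfolding integral_mult_right_zero integral_complex_of_real cheb_prod_orthogonal(2)[OF r]
    by (cases "m = k") simp_all
  then have "cheb_coeff r p k = (\<Sum>m\<in>S. if m = k then b k else 0)"
    unfolding cheb_coeff_eq pe
    by (subst Bochner_Integration.integral_sum) (intro integrable_mult_right i3, simp only:)
  also have "\<dots> = b k" using S by simp
  finally have "cheb_coeff r p k = b k" .
  moreover have "cheb_coeff r w k = cheb_coeff r (\<lambda>\<xi>. w \<xi> - p \<xi>) k + cheb_coeff r p k"
    unfolding cheb_coeff_eq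
    by (subst Bochner_Integration.integral_add[OF i1 i2, symmetric]) (simp add: algebra_simps)
  ultimately show ?thesis
    using cheb_coeff_bound(2)[OF r h le \<epsilon>, of k] by simp
qed

section \<open>The expansion of the Fourier transform\<close>

text \<open>
  The complement of the support is a union of possibly uncountably many open sets on which \<open>f\<close>
  vanishes almost everywhere; by the Lindeloef property countably many of them suffice.
\<close>

lemma AE_zero_outside_supp: "AE x in lebesgue. x \<notin> supp f \<longrightarrow> f x = 0"
proof -
  let ?\<U> = "{U. open U \<and> (AE x in lebesgue. x \<in> U \<longrightarrow> f x = 0)}"
  obtain \<V> where V: "\<V> \<subseteq> ?\<U>" "countable \<V>" "\<Union>\<V> = \<Union>?\<U>"
    by (rule Lindelof[of ?\<U>]) auto
  have "AE x in lebesgue. \<forall>U\<in>\<V>. x \<in> U \<longrightarrow> f x = 0"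
    using V by (subst AE_ball_countable) auto
  then show ?thesis
  proof (rule AE_mp, intro AE_I2 impI)
    fix x assume *: "\<forall>U\<in>\<V>. x \<in> U \<longrightarrow> f x = 0" and "x \<notin> supp f"
    then have "x \<in> \<Union>\<V>" unfolding V(3) supp_def by blast
    with * show "f x = 0" by blast
  qed
qed

definition fourier_coeff :: "real \<Rightarrow> (real ^ 'd \<Rightarrow> complex) \<Rightarrow> ('d \<Rightarrow> nat) \<Rightarrow> complex" where
  "fourier_coeff r v k = 1 / (2 * of_real pi) ^ CARD('d) * (\<integral>x. exp_coeff r k x * v x \<partial>lebesgue)"

definition fourier_partial :: "real \<Rightarrow> (real ^ 'd \<Rightarrow> complex) \<Rightarrow> nat \<Rightarrow> real ^ 'd \<Rightarrow> complex" where
  "fourier_partial r v n \<xi> =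
     (\<Sum>k | (\<Sum>j\<in>UNIV. k j) < n. fourier_coeff r v k * of_real (cheb_prod r k \<xi>))"

lemma exp_coeff_measurable [measurable]: "exp_coeff r k \<in> borel_measurable lebesgue"
proof -
  have "exp_coeff r k \<in> borel_measurable borel"
    unfolding exp_coeff_def
    by (intro borel_measurable_prod measurable_compose[OF _ borel_measurable_jacobi_anger]
        borel_measurable_continuous_onI continuous_intros)
  then show ?thesis by (intro measurable_completion) simp
qed

lemma norm_exp_coeff_le:
  assumes "r > 0" and x: "(\<Sum>j\<in>UNIV. \<bar>x $ j\<bar>) \<le> \<sigma>"
  shows "norm (exp_coeff r k (x :: real ^ 'd)) \<le> 2 ^ CARD('d) * exp (r * \<sigma>)"
proof -
  have "norm (exp_coeff r k x) \<le> (\<Prod>j\<in>(UNIV :: 'd set). 2 * exp (r * \<bar>x $ j\<bar>))"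
    unfolding exp_coeff_def prod_norm[symmetric]
  proof (intro prod_mono conjI)
    fix j
    have "norm (jacobi_anger (k j) (r * x $ j)) \<le> 2 ^ of_bool (k j > 0) * exp (r * \<bar>x $ j\<bar>)"
      using norm_jacobi_anger_le[of 1 "k j" "r * x $ j"] \<open>r > 0\<close> by (simp add: abs_mult)
    also have "\<dots> \<le> 2 * exp (r * \<bar>x $ j\<bar>)" by simp
    finally show "norm (jacobi_anger (k j) (r * x $ j)) \<le> 2 * exp (r * \<bar>x $ j\<bar>)" .
  qed simp
  also have "\<dots> = 2 ^ CARD('d) * exp (r * (\<Sum>j\<in>UNIV. \<bar>x $ j\<bar>))"
    by (simp add: prod.distrib exp_sum sum_distrib_left)
  also have "\<dots> \<le> 2 ^ CARD('d) * exp (r * \<sigma>)"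
    using x \<open>r > 0\<close> by simp
  finally show ?thesis .
qed

text \<open>
  The Fourier transform is a superposition of the exponentials \<open>exp (\<i> \<xi>\<cdot>x)\<close> with \<open>x\<close> in the
  support of \<open>v\<close>, where the tail estimate is uniform in \<open>x\<close>. Only finite sums are interchanged with the
  integral.
\<close>

lemma fourier_chebyshev_tail:
  fixes v :: "real ^ 'd \<Rightarrow> complex"
  assumes r: "r > 0" "R \<ge> r" and \<rho>: "\<rho> \<ge> 4 * R / r"
    and v: "integrable lebesgue v" and N: "(\<integral>x. norm (v x) \<partial>lebesgue) \<le> (2 * pi) ^ CARD('d) * N"
    and supp: "supp v \<subseteq> {x. (\<Sum>j\<in>UNIV. \<bar>x $ j\<bar>) \<le> \<sigma>}"
    and \<xi>: "\<xi> \<in> cube R" and n: "n > 0"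
  shows "norm (fourier v \<xi> - fourier_partial r v n \<xi>)
           \<le> ((13 / 3) ^ CARD('d) - 1) * (N * exp (r * \<sigma> * \<rho>)) * (4 * R / r / (3 * \<rho>)) ^ n"
proof -
  define C where "C = ((13 / 3) ^ CARD('d) - 1) * exp (r * \<sigma> * \<rho>) * (4 * R / r / (3 * \<rho>)) ^ n"
  let ?F = "{k :: 'd \<Rightarrow> nat. (\<Sum>j\<in>UNIV. k j) < n}"
  let ?e = "\<lambda>x. exp (\<i> * of_real (\<xi> \<bullet> x)) :: complex"
  let ?p = "\<lambda>x. \<Sum>k\<in>?F. exp_coeff r k x * of_real (cheb_prod r k \<xi>)"
  have [measurable]: "v \<in> borel_measurable lebesgue" using v by (rule borel_measurable_integrable)
  have AE_v: "AE x in lebesgue. v x \<noteq> 0 \<longrightarrow> (\<Sum>j\<in>UNIV. \<bar>x $ j\<bar>) \<le> \<sigma>"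
    using AE_zero_outside_supp[of v] by (rule AE_mp) (use supp in \<open>auto intro!: AE_I2\<close>)
  have [measurable]: "?e \<in> borel_measurable lebesgue"
    by (intro measurable_completion) (auto intro!: borel_measurable_continuous_onI continuous_intros)
  have ie: "integrable lebesgue (\<lambda>x. ?e x * v x)"
    by (rule Bochner_Integration.integrable_bound[OF v]) (auto simp: norm_mult)
  have ic: "integrable lebesgue (\<lambda>x. exp_coeff r k x * v x)" for k
  proof (rule Bochner_Integration.integrable_bound)
    show "integrable lebesgue (\<lambda>x. 2 ^ CARD('d) * exp (r * \<sigma>) * norm (v x))"
      using v by auto
    show "AE x in lebesgue. norm (exp_coeff r k x * v x) \<le> norm (2 ^ CARD('d) * exp (r * \<sigma>) * norm (v x))"
      using AE_v
    proof (rule AE_mp, intro AE_I2 impI)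
      fix x :: "real ^ 'd" assume "v x \<noteq> 0 \<longrightarrow> (\<Sum>j\<in>UNIV. \<bar>x $ j\<bar>) \<le> \<sigma>"
      then show "norm (exp_coeff r k x * v x) \<le> norm (2 ^ CARD('d) * exp (r * \<sigma>) * norm (v x))"
        using norm_exp_coeff_le[OF r(1), of x \<sigma> k] by (cases "v x = 0") (auto simp: norm_mult intro!: mult_right_mono)
    qed
  qed measurable
  have pv: "?p x * v x = (\<Sum>k\<in>?F. of_real (cheb_prod r k \<xi>) * (exp_coeff r k x * v x))" for x
    unfolding sum_distrib_right by (intro sum.cong refl) (simp add: mult_ac)
  have ip: "integrable lebesgue (\<lambda>x. ?p x * v x)"
  proof -
    have "integrable lebesgue (\<lambda>x. \<Sum>k\<in>?F. of_real (cheb_prod r k \<xi>) * (exp_coeff r k x * v x))"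
      by (intro Bochner_Integration.integrable_sum integrable_mult_right ic)
    then show ?thesis unfolding pv .
  qed
  have "(\<integral>x. ?p x * v x \<partial>lebesgue) = (\<integral>x. (\<Sum>k\<in>?F. of_real (cheb_prod r k \<xi>) * (exp_coeff r k x * v x)) \<partial>lebesgue)"
    unfolding pv ..
  also have "\<dots> = (\<Sum>k\<in>?F. of_real (cheb_prod r k \<xi>) * (\<integral>x. exp_coeff r k x * v x \<partial>lebesgue))"
    by (subst Bochner_Integration.integral_sum) (auto intro!: integrable_mult_right ic)
  finally have "fourier_partial r v n \<xi> = 1 / (2 * of_real pi) ^ CARD('d) * (\<integral>x. ?p x * v x \<partial>lebesgue)"
    unfolding fourier_partial_def fourier_coeff_def by (simp add: sum_distrib_left sum_divide_distrib mult_ac)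
  then have "fourier v \<xi> - fourier_partial r v n \<xi>
      = 1 / (2 * of_real pi) ^ CARD('d) * (\<integral>x. ?e x * v x - ?p x * v x \<partial>lebesgue)"
    unfolding fourier_def by (subst Bochner_Integration.integral_diff[OF ie ip]) (simp add: right_diff_distrib diff_divide_distrib)
  then have "norm (fourier v \<xi> - fourier_partial r v n \<xi>)
      = 1 / (2 * pi) ^ CARD('d) * norm (\<integral>x. ?e x * v x - ?p x * v x \<partial>lebesgue)"
    by (simp add: norm_mult norm_divide norm_power)
  also have "norm (\<integral>x. ?e x * v x - ?p x * v x \<partial>lebesgue) \<le> (\<integral>x. C * norm (v x) \<partial>lebesgue)"
  proof (rule norm_integral_le_AE)
    show "(\<lambda>x. ?e x * v x - ?p x * v x) \<in> borel_measurable lebesgue"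
      using ie ip by (intro borel_measurable_integrable Bochner_Integration.integrable_diff)
    show "integrable lebesgue (\<lambda>x. C * norm (v x))" using v by auto
    show "AE x in lebesgue. norm (?e x * v x - ?p x * v x) \<le> C * norm (v x)"
      using AE_v
    proof (rule AE_mp, intro AE_I2 impI)
      fix x :: "real ^ 'd" assume x: "v x \<noteq> 0 \<longrightarrow> (\<Sum>j\<in>UNIV. \<bar>x $ j\<bar>) \<le> \<sigma>"
      show "norm (?e x * v x - ?p x * v x) \<le> C * norm (v x)"
      proof (cases "v x = 0")
        case False
        with x have "norm (?e x - ?p x) \<le> C"
          unfolding C_def using exp_inner_expansion_tail[OF r \<rho> _ \<xi> n] by blast
        then have "norm (?e x - ?p x) * norm (v x) \<le> C * norm (v x)"
          by (intro mult_right_mono) auto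
        then show ?thesis by (simp add: left_diff_distrib flip: norm_mult)
      qed simp
    qed
  qed
  also have "(\<integral>x. C * norm (v x) \<partial>lebesgue) \<le> C * ((2 * pi) ^ CARD('d) * N)"
  proof -
    have "0 < \<rho>" using r \<rho> divide_pos_pos[of "4 * R" r] by linarith
    then have "C \<ge> 0" unfolding C_def using r by (intro mult_nonneg_nonneg zero_le_power) auto
    with N show ?thesis by (simp add: mult_left_mono)
  qed
  finally have "norm (fourier v \<xi> - fourier_partial r v n \<xi>)
      \<le> 1 / (2 * pi) ^ CARD('d) * (C * ((2 * pi) ^ CARD('d) * N))"
    by (simp add: divide_right_mono)
  also have "\<dots> = C * N" by simp
  finally show ?thesis unfolding C_def by (simp add: mult_ac)
qed

section \<open>Balancing the two errors\<close>

text \<open>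
  The factor \<open>2\<close> between \<open>2s\<close> and \<open>4s\<close> pays for the number of multi-indices: in
  \<open>(2s)\<^sup>m = (4s)\<^sup>m 2\<^sup>-\<^sup>m\<close> the first factor is largest at \<open>m = n - 1\<close>, and the sum of \<open>2\<^sup>-\<^sup>m\<close> over
  all multi-indices is \<open>2\<^sup>d\<close>.
\<close>

lemma sum_power_multi_index_le:
  fixes s :: real
  assumes s: "s \<ge> 1" and n: "n > 0"
  shows "(\<Sum>k::'d::finite \<Rightarrow> nat | (\<Sum>j\<in>UNIV. k j) < n. (2 * s) ^ (\<Sum>j\<in>UNIV. k j)) \<le> 2 ^ CARD('d) * (4 * s) ^ (n - 1)"
proof -
  let ?F = "{k::'d \<Rightarrow> nat. (\<Sum>j\<in>UNIV. k j) < n}"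
  have "(\<Sum>k\<in>?F. (2 * s) ^ (\<Sum>j\<in>UNIV. k j)) \<le> (\<Sum>k\<in>?F. (4 * s) ^ (n - 1) * (1 / 2) ^ (\<Sum>j\<in>UNIV. k j))"
  proof (rule sum_mono)
    fix k assume "k \<in> ?F"
    let ?m = "\<Sum>j\<in>UNIV. k j"
    have "(2 * s) ^ ?m = (4 * s) ^ ?m * (1 / 2) ^ ?m"
      unfolding power_mult_distrib[symmetric] by simp
    also have "\<dots> \<le> (4 * s) ^ (n - 1) * (1 / 2) ^ ?m"
      using \<open>k \<in> ?F\<close> s by (intro mult_right_mono power_increasing) auto
    finally show "(2 * s) ^ ?m \<le> (4 * s) ^ (n - 1) * (1 / 2) ^ ?m" .
  qed
  also have "\<dots> = (4 * s) ^ (n - 1) * (\<Sum>k\<in>?F. (1 / 2) ^ (\<Sum>j\<in>UNIV. k j))"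
    by (simp add: sum_distrib_left)
  also have "(\<Sum>k\<in>?F. (1 / 2 :: real) ^ (\<Sum>j\<in>UNIV. k j)) \<le> (1 / (1 - 1 / 2)) ^ CARD('d)"
    by (rule has_sum_mono2[OF has_sum_finite[OF finite_multi_indices] geometric_multi_index_has_sum]) auto
  finally show ?thesis using s by (simp add: mult_ac mult_left_mono)
qed

text \<open>On the left are the constants of the truncation error and of the data error.\<close>

lemma dimension_constant: "(13 / 3 :: real) ^ d - 1 + 2 ^ d \<le> (16 / 3) ^ d"
proof (induction d)
  case (Suc d)
  have aux: "13 / 3 * a - 1 + 2 * b \<le> 16 / 3 * (a - 1 + b)" if "1 \<le> a" "1 \<le> b" for a b :: real
    using that by (simp add: field_simps)
  have "1 \<le> (13 / 3 :: real) ^ d" "1 \<le> (2 :: real) ^ d" by (rule one_le_power; simp)+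
  then have "(13 / 3 :: real) ^ Suc d - 1 + 2 ^ Suc d \<le> 16 / 3 * ((13 / 3) ^ d - 1 + 2 ^ d)"
    unfolding power_Suc by (rule aux)
  also have "\<dots> \<le> (16 / 3) ^ Suc d" unfolding power_Suc by (rule mult_left_mono[OF Suc.IH]) simp
  finally show ?case .
qed simp

text \<open>
  The degree \<open>n = \<lceil>L\<rceil>\<close> balances the data error, which grows like \<open>B\<^sup>n\<^sup>-\<^sup>1\<close>, and the truncation error,
  which decays like \<open>\<kappa> (B/(3\<rho>))\<^sup>n\<close>: since \<open>(3\<rho>)\<^sup>L = \<kappa>\<close>, both equal \<open>B\<^sup>L = \<kappa>\<^sup>\<tau>\<close> when the
  exponent \<open>n - 1\<close> or \<open>n\<close> is replaced by \<open>L\<close>.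
\<close>

lemma degree_choice:
  fixes B \<rho> \<kappa> :: real
  defines "L \<equiv> ln \<kappa> / ln (3 * \<rho>)" and "\<tau> \<equiv> ln B / ln (3 * \<rho>)"
  assumes B: "4 \<le> B" "B \<le> \<rho>" and \<kappa>: "\<kappa> > 1"
  shows "nat \<lceil>L\<rceil> > 0" and "1 \<le> \<kappa> powr \<tau>"
    and "B ^ (nat \<lceil>L\<rceil> - 1) \<le> \<kappa> powr \<tau>" and "\<kappa> * (B / (3 * \<rho>)) ^ nat \<lceil>L\<rceil> \<le> \<kappa> powr \<tau>"
proof -
  have l3: "ln (3 * \<rho>) > 0" using B by (intro ln_gt_zero) linarith
  have L: "L > 0" unfolding L_def using l3 \<kappa> by simp
  then show n: "nat \<lceil>L\<rceil> > 0" by simp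
  have nL: "L \<le> real (nat \<lceil>L\<rceil>)" "real (nat \<lceil>L\<rceil> - 1) \<le> L"
    using L by linarith+
  have X: "\<kappa> powr \<tau> = B powr L"
    using B \<kappa> by (simp add: powr_def L_def \<tau>_def mult.commute)
  have K: "(3 * \<rho>) powr L = \<kappa>"
    using B \<kappa> l3 by (simp add: powr_def L_def)
  have "B ^ (nat \<lceil>L\<rceil> - 1) = B powr real (nat \<lceil>L\<rceil> - 1)" using B by (simp add: powr_realpow)
  also have "\<dots> \<le> B powr L" using nL B by (intro powr_mono) auto
  finally show "B ^ (nat \<lceil>L\<rceil> - 1) \<le> \<kappa> powr \<tau>" unfolding X .
  show "1 \<le> \<kappa> powr \<tau>" unfolding X using B L by (intro ge_one_powr_ge_zero) auto
  have "(B / (3 * \<rho>)) ^ nat \<lceil>L\<rceil> = (B / (3 * \<rho>)) powr real (nat \<lceil>L\<rceil>)" using B by (simp add: powr_realpow)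
  also have "\<dots> \<le> (B / (3 * \<rho>)) powr L" using nL B by (intro powr_mono') auto
  also have "\<dots> = B powr L / \<kappa>" using B K by (simp add: powr_divide)
  finally show "\<kappa> * (B / (3 * \<rho>)) ^ nat \<lceil>L\<rceil> \<le> \<kappa> powr \<tau>"
    unfolding X using \<kappa> by (simp add: field_simps)
qed

lemma Linf_norm_le_iff_AE:
  assumes "c \<ge> 0"
  shows "Linf_norm S f \<le> ennreal c \<longleftrightarrow>
           f \<in> borel_measurable (lebesgue_on S) \<and> (AE x in lebesgue_on S. norm (f x) \<le> c)"
proof (cases "f \<in> borel_measurable (lebesgue_on S)")
  case True
  then have m: "(\<lambda>x. ennreal (norm (f x))) \<in> borel_measurable (lebesgue_on S)" by measurable
  have "esssup (lebesgue_on S) (\<lambda>x. ennreal (norm (f x))) \<le> ennreal c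
      \<longleftrightarrow> (AE x in lebesgue_on S. ennreal (norm (f x)) \<le> ennreal c)"
    using esssup_AE[where M = "lebesgue_on S" and f = "\<lambda>x. ennreal (norm (f x))"] m
    by (auto intro: esssup_I elim!: eventually_mono order_trans)
  with True assms show ?thesis by (simp add: Linf_norm_def)
qed (auto simp: Linf_norm_def top_unique)

text \<open>
  The number \<open>fourier_coeff r v k\<close> is the Chebyshev coefficient of \<open>fourier v\<close>. This is obtained together
  with the perturbation bound by comparing \<open>w\<close> with the partial sums of the expansion, which are
  within \<open>\<delta> + e n\<close> of \<open>w\<close>, and letting \<open>n\<close> tend to infinity.
\<close>

lemma cheb_coeff_fourier_error:
  fixes v w :: "real ^ 'd \<Rightarrow> complex"
  assumes r: "r > 0" and e: "e \<longlonglongrightarrow> 0"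
    and tail: "\<And>\<xi> n. \<xi> \<in> cube r \<Longrightarrow> norm (fourier v \<xi> - fourier_partial r v (Suc n) \<xi>) \<le> e n"
    and F: "fourier v \<in> borel_measurable (lebesgue_on (cube r))"
    and w: "(\<lambda>\<xi>. w \<xi> - fourier v \<xi>) \<in> borel_measurable (lebesgue_on (cube r))"
    and le: "AE \<xi> in lebesgue_on (cube r). norm (w \<xi> - fourier v \<xi>) \<le> \<delta>"
    and \<delta>: "\<delta> \<ge> 0"
  shows "norm (cheb_coeff r w k - fourier_coeff r v k) \<le> \<delta> * (\<Prod>j\<in>UNIV. 2 ^ of_bool (k j > 0))"
proof (rule LIMSEQ_le_const)
  show "(\<lambda>n. (\<delta> + e n) * (\<Prod>j\<in>UNIV. 2 ^ of_bool (k j > 0)))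
      \<longlonglongrightarrow> \<delta> * (\<Prod>j\<in>UNIV. 2 ^ of_bool (k j > 0))"
    using tendsto_mult_right[OF tendsto_add[OF tendsto_const e]] by simp
  have "norm (cheb_coeff r w k - fourier_coeff r v k) \<le> (\<delta> + e n) * (\<Prod>j\<in>UNIV. 2 ^ of_bool (k j > 0))"
    if n: "n \<ge> (\<Sum>j\<in>UNIV. k j)" for n
  proof (rule cheb_coeff_near_polynomial[where p = "fourier_partial r v (Suc n)" and S = "{k. (\<Sum>j\<in>UNIV. k j) < Suc n}"])
    have "0 \<in> cube r" using r by (simp add: cube_def)
    from order_trans[OF norm_ge_zero tail[OF this]] \<delta> show "\<delta> + e n \<ge> 0" by simp
    have p: "fourier_partial r v (Suc n) \<in> borel_measurable (lebesgue_on (cube r))"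
      unfolding fourier_partial_def cheb_prod_def
      by (intro continuous_imp_measurable_on_sets_lebesgue cube_measurable continuous_intros) (use r in auto)
    have "(\<lambda>\<xi>. (w \<xi> - fourier v \<xi>) + (fourier v \<xi> - fourier_partial r v (Suc n) \<xi>)) \<in> borel_measurable (lebesgue_on (cube r))"
      using w F p by measurable
    then show "(\<lambda>\<xi>. w \<xi> - fourier_partial r v (Suc n) \<xi>) \<in> borel_measurable (lebesgue_on (cube r))" by simp
    show "AE \<xi> in lebesgue_on (cube r). norm (w \<xi> - fourier_partial r v (Suc n) \<xi>) \<le> \<delta> + e n"
      using le
    proof (rule AE_mp, intro AE_I2 impI)
      fix \<xi> :: "real^'d" assume "\<xi> \<in> space (lebesgue_on (cube r))" and *: "norm (w \<xi> - fourier v \<xi>) \<le> \<delta>"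
      then have "\<xi> \<in> cube r" by simp
      with * have "norm (w \<xi> - fourier v \<xi>) + norm (fourier v \<xi> - fourier_partial r v (Suc n) \<xi>) \<le> \<delta> + e n"
        using tail by (intro add_mono)
      then show "norm (w \<xi> - fourier_partial r v (Suc n) \<xi>) \<le> \<delta> + e n"
        using norm_triangle_ineq[of "w \<xi> - fourier v \<xi>" "fourier v \<xi> - fourier_partial r v (Suc n) \<xi>"] by simp
    qed
  qed (use n r finite_multi_indices in \<open>auto simp: fourier_partial_def\<close>)
  then show "\<exists>M. \<forall>n\<ge>M. norm (cheb_coeff r w k - fourier_coeff r v k) \<le> (\<delta> + e n) * (\<Prod>j\<in>UNIV. 2 ^ of_bool (k j > 0))"
    by blast
qed

theorem theorem2p2:
  fixes v w :: "real ^ 'd \<Rightarrow> complex"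
    and N \<delta> r \<sigma> \<rho> R :: real
  assumes "N > 0" and "\<delta> > 0" and "r > 0" and "\<sigma> > 0"
    and "L1_norm v \<le> ennreal ((2 * pi) ^ CARD('d) * N)"
    and "supp v \<subseteq> {x. (\<Sum>j\<in>UNIV. \<bar>x $ j\<bar>) \<le> \<sigma>}"
    and "Linf_norm (cube r) (\<lambda>\<xi>. w \<xi> - fourier v \<xi>) \<le> ennreal \<delta>" and "\<delta> < N"
    and "\<rho> > 0" and "R > 0" and "R \<ge> r" and "\<rho> \<ge> 4 * R / r"
  shows "let n = nat \<lceil>(ln (N / \<delta>) + r * \<sigma> * \<rho>) / ln (3 * \<rho>)\<rceil>;
             \<tau> = ln (4 * R / r) / ln (3 * \<rho>)
         in Linf_norm (cube R) (\<lambda>\<xi>. fourier v \<xi> - cheb_extend r R n w \<xi>)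
              \<le> ennreal ((16 / 3) ^ CARD('d) * (R / r) *
                         (N * exp (r * \<sigma> * \<rho>) / \<delta>) powr \<tau> * \<delta>)"
proof -
  define B where "B = 4 * R / r"
  define \<kappa> where "\<kappa> = N * exp (r * \<sigma> * \<rho>) / \<delta>"
  define \<tau> where "\<tau> = ln B / ln (3 * \<rho>)"
  define X where "X = \<kappa> powr \<tau>"
  define n where "n = nat \<lceil>(ln (N / \<delta>) + r * \<sigma> * \<rho>) / ln (3 * \<rho>)\<rceil>"
  define D where "D = (13 / 3 :: real) ^ CARD('d) - 1"
  define e where "e m = D * (N * exp (r * \<sigma> * \<rho>)) * (B / (3 * \<rho>)) ^ Suc m" for m
  note r = \<open>r > 0\<close>
  have B: "4 \<le> B" "B \<le> \<rho>" using assms by (simp_all add: B_def field_simps)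
  have "1 < N / \<delta> * exp (r * \<sigma> * \<rho>)" using assms by (intro less_1_mult) auto
  then have \<kappa>: "\<kappa> > 1" by (simp add: \<kappa>_def)
  have ln\<kappa>: "ln \<kappa> = ln (N / \<delta>) + r * \<sigma> * \<rho>"
    using assms by (simp add: \<kappa>_def ln_mult ln_div)
  have n: "n > 0" and X1: "1 \<le> X" and X2: "B ^ (n - 1) \<le> X" and X3: "\<kappa> * (B / (3 * \<rho>)) ^ n \<le> X"
    using degree_choice[OF B \<kappa>] unfolding n_def X_def \<tau>_def ln\<kappa>[symmetric] by auto
  have D0: "D \<ge> 0" unfolding D_def by simp

  have v: "integrable lebesgue v" and vN: "(\<integral>x. norm (v x) \<partial>lebesgue) \<le> (2 * pi) ^ CARD('d) * N"
  proof -
    have m: "v \<in> borel_measurable lebesgue"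
      using assms(5) by (auto simp: L1_norm_def top_unique split: if_splits)
    with assms(5) have le: "(\<integral>\<^sup>+ x. ennreal (norm (v x)) \<partial>lebesgue) \<le> ennreal ((2 * pi) ^ CARD('d) * N)"
      by (simp add: L1_norm_def)
    with m show v: "integrable lebesgue v"
      by (auto simp: integrable_iff_bounded intro: le_less_trans)
    show "(\<integral>x. norm (v x) \<partial>lebesgue) \<le> (2 * pi) ^ CARD('d) * N"
      using le nn_integral_eq_integral[OF integrable_norm[OF v]] \<open>N > 0\<close> by simp
  qed
  have tail: "norm (fourier v \<xi> - fourier_partial r v (Suc m) \<xi>) \<le> e m" if "\<xi> \<in> cube R" for \<xi> m
    unfolding e_def B_def D_def
    using that assms v vN by (intro fourier_chebyshev_tail) auto
  have e0: "e \<longlonglongrightarrow> 0"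
  proof -
    have "(\<lambda>m. D * (N * exp (r * \<sigma> * \<rho>)) * (B / (3 * \<rho>)) ^ Suc m) \<longlonglongrightarrow> D * (N * exp (r * \<sigma> * \<rho>)) * 0"
      using B by (intro tendsto_intros LIMSEQ_Suc[OF LIMSEQ_realpow_zero]) auto
    then show ?thesis unfolding e_def by simp
  qed
  have sub: "cube r \<subseteq> (cube R :: (real ^ 'd) set)" 
  proof
    fix \<xi> :: "real ^ 'd" assume "\<xi> \<in> cube r"
    then have "-r \<le> \<xi> $ j \<and> \<xi> $ j \<le> r" for j by (simp add: cube_def)
    then have "-R \<le> \<xi> $ j \<and> \<xi> $ j \<le> R" for j using \<open>R \<ge> r\<close> by (smt (verit))
    then show "\<xi> \<in> cube R" by (simp add: cube_def)
  qed
  \<comment> \<open>Measurability of the Fourier transform comes for free, as a limit of polynomials.\<close>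
  have FR: "fourier v \<in> borel_measurable (lebesgue_on (cube R))"
  proof (rule borel_measurable_LIMSEQ_metric)
    show "fourier_partial r v (Suc m) \<in> borel_measurable (lebesgue_on (cube R))" for m
      unfolding fourier_partial_def cheb_prod_def
      by (intro continuous_imp_measurable_on_sets_lebesgue cube_measurable continuous_intros) (use r in auto)
    fix \<xi> :: "real ^ 'd" assume "\<xi> \<in> space (lebesgue_on (cube R))"
    then have "norm (fourier_partial r v (Suc m) \<xi> - fourier v \<xi>) \<le> e m" for m
      using tail by (simp add: norm_minus_commute)
    then show "(\<lambda>m. fourier_partial r v (Suc m) \<xi>) \<longlonglongrightarrow> fourier v \<xi>"
      by (intro LIM_zero_cancel[OF Lim_null_comparison[OF _ e0]] always_eventually) auto
  qed
  then have Fr: "fourier v \<in> borel_measurable (lebesgue_on (cube r))"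
    using sub by (rule measurable_restrict_mono)
  have wF: "(\<lambda>\<xi>. w \<xi> - fourier v \<xi>) \<in> borel_measurable (lebesgue_on (cube r))"
    and w\<delta>: "AE \<xi> in lebesgue_on (cube r). norm (w \<xi> - fourier v \<xi>) \<le> \<delta>"
    using assms(7) Linf_norm_le_iff_AE[of \<delta> "cube r" "\<lambda>\<xi>. w \<xi> - fourier v \<xi>"] \<open>\<delta> > 0\<close> by auto
  have coeff: "norm (cheb_coeff r w k - fourier_coeff r v k) \<le> \<delta> * (\<Prod>j\<in>UNIV. 2 ^ of_bool (k j > 0))" for k
    using r e0 _ Fr wF w\<delta> by (rule cheb_coeff_fourier_error) (use tail sub \<open>\<delta> > 0\<close> in auto)

  define P where "P \<xi> = (\<Sum>k | (\<Sum>j\<in>UNIV. k j) < n. cheb_coeff r w k * of_real (cheb_prod r k \<xi>))" for \<xi>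
  have outside: "norm (fourier v \<xi> - P \<xi>) \<le> (16 / 3) ^ CARD('d) * X * \<delta>" if \<xi>: "\<xi> \<in> cube R" for \<xi>
  proof -
    let ?F = "{k :: 'd \<Rightarrow> nat. (\<Sum>j\<in>UNIV. k j) < n}"
    have "norm (fourier v \<xi> - fourier_partial r v n \<xi>) \<le> e (n - 1)"
      using tail[OF \<xi>, of "n - 1"] n by simp
    also have "\<dots> = D * \<delta> * (\<kappa> * (B / (3 * \<rho>)) ^ n)"
      using n \<open>\<delta> > 0\<close> by (simp add: e_def \<kappa>_def)
    also have "\<dots> \<le> D * \<delta> * X"
      using X3 D0 \<open>\<delta> > 0\<close> by (intro mult_left_mono) auto
    finally have 1: "norm (fourier v \<xi> - fourier_partial r v n \<xi>) \<le> D * \<delta> * X" .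
    have "fourier_partial r v n \<xi> - P \<xi>
        = (\<Sum>k\<in>?F. (fourier_coeff r v k - cheb_coeff r w k) * of_real (cheb_prod r k \<xi>))"
      by (simp add: fourier_partial_def P_def sum_subtractf left_diff_distrib)
    also have "norm \<dots> \<le> (\<Sum>k\<in>?F. \<delta> * (2 * (R / r)) ^ (\<Sum>j\<in>UNIV. k j))"
    proof (rule sum_norm_le)
      fix k :: "'d \<Rightarrow> nat"
      have "norm ((fourier_coeff r v k - cheb_coeff r w k) * of_real (cheb_prod r k \<xi>))
          \<le> \<delta> * (\<Prod>j\<in>UNIV. 2 ^ of_bool (k j > 0)) * \<bar>cheb_prod r k \<xi>\<bar>"
        unfolding norm_mult norm_of_real using coeff[of k]
        by (intro mult_right_mono) (auto simp: norm_minus_commute)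
      also have "\<dots> = \<delta> * (\<Prod>j\<in>UNIV. 2 ^ of_bool (k j > 0) * \<bar>poly (chebyshev_T (k j)) (\<xi> $ j / r)\<bar>)"
        by (simp add: cheb_prod_def abs_prod prod.distrib)
      also have "\<dots> \<le> \<delta> * (\<Prod>j\<in>UNIV. (2 * (R / r)) ^ k j)"
      proof (intro mult_left_mono prod_mono conjI)
        fix j
        have "\<bar>\<xi> $ j\<bar> \<le> R" using \<xi> by (auto simp: cube_def abs_le_iff) (smt (verit))
        then have "\<bar>\<xi> $ j / r\<bar> \<le> R / r" using r by (simp add: divide_right_mono)
        then show "2 ^ of_bool (k j > 0) * \<bar>poly (chebyshev_T (k j)) (\<xi> $ j / r)\<bar> \<le> (2 * (R / r)) ^ k j"
          using r \<open>R \<ge> r\<close> by (intro chebyshev_T_growth) auto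
      qed (use \<open>\<delta> > 0\<close> in auto)
      finally show "norm ((fourier_coeff r v k - cheb_coeff r w k) * of_real (cheb_prod r k \<xi>))
          \<le> \<delta> * (2 * (R / r)) ^ (\<Sum>j\<in>UNIV. k j)"
        by (simp add: power_sum)
    qed
    also have "\<dots> = \<delta> * (\<Sum>k\<in>?F. (2 * (R / r)) ^ (\<Sum>j\<in>UNIV. k j))"
      by (simp add: sum_distrib_left)
    also have "\<dots> \<le> \<delta> * (2 ^ CARD('d) * (4 * (R / r)) ^ (n - 1))"
      using r \<open>R \<ge> r\<close> n \<open>\<delta> > 0\<close> by (intro mult_left_mono sum_power_multi_index_le) auto
    also have "\<dots> \<le> \<delta> * (2 ^ CARD('d) * X)"
      using X2 \<open>\<delta> > 0\<close> by (intro mult_left_mono) (auto simp: B_def)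
    finally have 2: "norm (fourier_partial r v n \<xi> - P \<xi>) \<le> \<delta> * (2 ^ CARD('d) * X)" .
    have "norm (fourier v \<xi> - P \<xi>) \<le> norm (fourier v \<xi> - fourier_partial r v n \<xi>) + norm (fourier_partial r v n \<xi> - P \<xi>)"
      using norm_triangle_ineq[of "fourier v \<xi> - fourier_partial r v n \<xi>" "fourier_partial r v n \<xi> - P \<xi>"] by simp
    also have "\<dots> \<le> (D + 2 ^ CARD('d)) * (X * \<delta>)" using 1 2 by (simp add: algebra_simps)
    also have "\<dots> \<le> (16 / 3) ^ CARD('d) * (X * \<delta>)"
      unfolding D_def using X1 \<open>\<delta> > 0\<close> by (intro mult_right_mono dimension_constant) auto
    finally show ?thesis by simp
  qed

  let ?C = "cheb_extend r R n w"
  let ?c = "(16 / 3) ^ CARD('d) * (R / r) * X * \<delta>"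
  have c1: "(16 / 3) ^ CARD('d) * X * \<delta> \<le> ?c"
  proof -
    have "(16 / 3) ^ CARD('d) * X * \<delta> * 1 \<le> (16 / 3) ^ CARD('d) * X * \<delta> * (R / r)"
      using r \<open>R \<ge> r\<close> X1 \<open>\<delta> > 0\<close> by (intro mult_left_mono) auto
    then show ?thesis by (simp add: mult_ac)
  qed
  have c2: "\<delta> \<le> (16 / 3) ^ CARD('d) * X * \<delta>"
  proof -
    have "1 * 1 \<le> (16 / 3) ^ CARD('d) * X"
      using X1 by (intro mult_mono one_le_power) auto
    then show ?thesis using \<open>\<delta> > 0\<close> by simp
  qed
  have C: "fourier v \<xi> - ?C \<xi> = (if \<xi> \<in> cube r then fourier v \<xi> - w \<xi> else fourier v \<xi> - P \<xi>)"
    if "\<xi> \<in> cube R" for \<xi>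
    using that by (simp add: cheb_extend_def P_def cheb_prod_def)
  have meas: "(\<lambda>\<xi>. fourier v \<xi> - ?C \<xi>) \<in> borel_measurable (lebesgue_on (cube R))"
  proof -
    have "P \<in> borel_measurable (lebesgue_on (cube R))"
      unfolding P_def cheb_prod_def
      by (intro continuous_imp_measurable_on_sets_lebesgue cube_measurable continuous_intros) (use r in auto)
    with FR have "(\<lambda>\<xi>. fourier v \<xi> - P \<xi>) \<in> borel_measurable (lebesgue_on (cube R))" by measurable
    then have mP: "(\<lambda>\<xi>. indicator (cube R) \<xi> *\<^sub>R (fourier v \<xi> - P \<xi>)) \<in> borel_measurable lebesgue"
      by (subst (asm) borel_measurable_restrict_space_iff) auto
    have mw: "(\<lambda>\<xi>. indicator (cube r) \<xi> *\<^sub>R (w \<xi> - fourier v \<xi>)) \<in> borel_measurable lebesgue"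
      using wF by (subst (asm) borel_measurable_restrict_space_iff) auto
    have "(\<lambda>\<xi>. if \<xi> \<in> cube r then - (indicator (cube r) \<xi> *\<^sub>R (w \<xi> - fourier v \<xi>))
        else indicator (cube R) \<xi> *\<^sub>R (fourier v \<xi> - P \<xi>)) \<in> borel_measurable lebesgue"
      using mP mw by (intro measurable_If_set borel_measurable_uminus) auto
    also have "(\<lambda>\<xi>. if \<xi> \<in> cube r then - (indicator (cube r) \<xi> *\<^sub>R (w \<xi> - fourier v \<xi>))
        else indicator (cube R) \<xi> *\<^sub>R (fourier v \<xi> - P \<xi>)) = (\<lambda>\<xi>. indicator (cube R) \<xi> *\<^sub>R (fourier v \<xi> - ?C \<xi>))"
    proof
      fix \<xi> :: "real ^ 'd"
      show "(if \<xi> \<in> cube r then - (indicator (cube r) \<xi> *\<^sub>R (w \<xi> - fourier v \<xi>))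
        else indicator (cube R) \<xi> *\<^sub>R (fourier v \<xi> - P \<xi>)) = indicator (cube R) \<xi> *\<^sub>R (fourier v \<xi> - ?C \<xi>)"
      proof (cases "\<xi> \<in> cube R")
        case True
        then show ?thesis unfolding C[OF True] using sub by (auto simp: indicator_def)
      qed (use sub in auto)
    qed
    finally show ?thesis by (subst borel_measurable_restrict_space_iff) auto
  qed
  have "AE \<xi> in lebesgue. \<xi> \<in> cube r \<longrightarrow> norm (w \<xi> - fourier v \<xi>) \<le> \<delta>"
    using w\<delta> by (subst (asm) AE_restrict_space_iff) auto
  then have "AE \<xi> in lebesgue. \<xi> \<in> cube R \<longrightarrow> norm (fourier v \<xi> - ?C \<xi>) \<le> ?c"
  proof (rule AE_mp, intro AE_I2 impI)
    fix \<xi> assume *: "\<xi> \<in> cube r \<longrightarrow> norm (w \<xi> - fourier v \<xi>) \<le> \<delta>" and \<xi>: "\<xi> \<in> cube R"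
    have "norm (fourier v \<xi> - ?C \<xi>) \<le> (16 / 3) ^ CARD('d) * X * \<delta>"
      using * outside[OF \<xi>] c2 by (auto simp: C[OF \<xi>] norm_minus_commute)
    with c1 show "norm (fourier v \<xi> - ?C \<xi>) \<le> ?c" by linarith
  qed
  then have "AE \<xi> in lebesgue_on (cube R). norm (fourier v \<xi> - ?C \<xi>) \<le> ?c"
    by (subst AE_restrict_space_iff) auto
  with meas have "Linf_norm (cube R) (\<lambda>\<xi>. fourier v \<xi> - ?C \<xi>) \<le> ennreal ?c"
    using r \<open>R \<ge> r\<close> X1 \<open>\<delta> > 0\<close> by (subst Linf_norm_le_iff_AE) auto
  then show ?thesis
    unfolding Let_def n_def X_def \<kappa>_def \<tau>_def B_def .
qed

end
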